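(* Let $m\ge 0$ be an integer and let $a,b,c\in\mathbb{C}$ satisfy $|a|=1$, $\bar a b+\bar b=0$, $|c|^2e^{|b|^2}=1$. Let $\psi,\varphi,\phi$ be entire functions with $\phi\not\equiv 0$, and suppose that $\psi$ is zero free. Let $\mathbb{S}$ be a multi-valued weighted composition operator on $\mathcal{F}^2$ induced by the equation $\psi\cdot f\circ\varphi=\phi\cdot g^{(m)}$, and let $\mathbb{S}_{\max}$ be the corresponding maximal operator. Then $\mathbb{S}$ is $\mathcal{C}_{a,b,c}$-selfadjoint if and only if the following two conditions hold. (1) $\mathbb{S}=\mathbb{S}_{\max}$. (2) There is a triple $(\psi_1,\varphi,\phi_1)$ equivalent to $(\psi,\varphi,\phi)$ and complex constants $A,B,C$ such that, with $D=b+aB-bA$, $$\varphi(y)=Ay+B,\qquad Ce^{Dy}\phi_1(y)=\psi_1(y)\,[a(Ay+B)+b]^m,\qquad y\in\mathbb{C}.$$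
   Context: Fock space $\mathcal{F}^2$ is the Hilbert space of entire functions $f$ with $\int_{\mathbb{C}}|f(z)|^2e^{-|z|^2}dV(z)<\infty$, with inner product $\langle f,g\rangle=\frac1\pi\int_{\mathbb{C}}f(z)\overline{g(z)}e^{-|z|^2}dV(z)$, where $dV$ is area measure. A multi-valued linear operator $\mathbb{A}$ on a Hilbert space $\mathcal{H}$ assigns to each $x$ in a subspace $\mathrm{dom}(\mathbb{A})\subset\mathcal{H}$ a nonempty subset $\mathbb{A}(x)\subset\mathcal{H}$ such that its graph $G(\mathbb{A})=\{(x,y):x\in\mathrm{dom}(\mathbb{A}),\,y\in\mathbb{A}(x)\}$ is a linear subspace of $\mathcal{H}\times\mathcal{H}$; $\mathbb{A}$ is determined by $G(\mathbb{A})$. The maximal operator $\mathbb{S}_{\max}$ is given by $G(\mathbb{S}_{\max})=\{(f,g)\in\mathcal{F}^2\times\mathcal{F}^2:\psi(z)f(\varphi(z))=\phi(z)g^{(m)}(z)\ \forall z\in\mathbb{C}\}$. A multi-valued weighted composition operator induced by the equation is any multi-valued linear operator $\mathbb{S}$ on $\mathcal{F}^2$ with $G(\mathbb{S})\subset G(\mathbb{S}_{\max})$. The weighted composition conjugation is $\mathcal{C}_{a,b,c}f(z)=ce^{bz}\overline{f(\overline{az+b})}$, $f\in\mathcal{F}^2$; under the stated conditions on $a,b,c$ it is an anti-linear isometric involution of $\mathcal{F}^2$. For a conjugation $\mathcal{C}$, the $\mathcal{C}$-adjoint $\mathbb{A}^*_{\mathcal{C}}$ is given by $G(\mathbb{A}^*_{\mathcal{C}})=\{(u,v):\langle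 g,\mathcal{C}u\rangle=\langle f,\mathcal{C}v\rangle\ \forall (f,g)\in G(\mathbb{A})\}$, and $\mathbb{A}$ is $\mathcal{C}$-selfadjoint if $G(\mathbb{A}^*_{\mathcal{C}})=G(\mathbb{A})$. Triples of entire functions $(\psi,\varphi,\phi)$ and $(\psi_1,\varphi,\phi_1)$ (with $\psi,\psi_1\not\equiv0$) are equivalent if $\phi/\psi=\phi_1/\psi_1$ as meromorphic functions.
   Formalization: The formal theorem additionally assumes that m = 0 or φ (the inner map φ(y)=Ay+B) is nonconstant; for m ≥ 1 and constant inner map the claim fails, e.g. m=a=c=1, b=0, ψ=1, inner map 1, multiplier e^{-z}. *)

theory Defs
  imports "HOL-Complex_Analysis.Complex_Analysis"
begin

definition fock_space :: "(complex \<Rightarrow> complex) set" where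
  "fock_space =
     {f. f holomorphic_on UNIV \<and>
         integrable lborel (\<lambda>z. (cmod (f z))\<^sup>2 * exp (- (cmod z)\<^sup>2))}"

definition fock_inner :: "(complex \<Rightarrow> complex) \<Rightarrow> (complex \<Rightarrow> complex) \<Rightarrow> complex" where
  "fock_inner f g =
     (1 / of_real pi) *
     (LINT z|lborel. f z * cnj (g z) * of_real (exp (- (cmod z)\<^sup>2)))"

text \<open>
  A multi-valued operator is identified with its graph; its domain is the first projection of
  the graph, and the values at \<open>f\<close> are the \<open>g\<close> with \<open>(f, g)\<close> in the graph.
\<close>

type_synonym fock_graph = "((complex \<Rightarrow> complex) \<times> (complex \<Rightarrow> complex)) set"

definition multivalued_linear_operator :: "fock_graph \<Rightarrow> bool" where
  "multivalued_linear_operator G \<longleftrightarrow>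
     G \<subseteq> fock_space \<times> fock_space \<and>
     ((\<lambda>z. 0), (\<lambda>z. 0)) \<in> G \<and>
     (\<forall>f g u v. (f, g) \<in> G \<longrightarrow> (u, v) \<in> G \<longrightarrow>
        ((\<lambda>z. f z + u z), (\<lambda>z. g z + v z)) \<in> G) \<and>
     (\<forall>k f g. (f, g) \<in> G \<longrightarrow> ((\<lambda>z. k * f z), (\<lambda>z. k * g z)) \<in> G)"

definition S_max ::
  "nat \<Rightarrow> (complex \<Rightarrow> complex) \<Rightarrow> (complex \<Rightarrow> complex) \<Rightarrow> (complex \<Rightarrow> complex) \<Rightarrow> fock_graph" where
  "S_max m psi varphi phi =
     {(f, g). f \<in> fock_space \<and> g \<in> fock_space \<and>
        (\<forall>z. psi z * f (varphi z) = phi z * (deriv ^^ m) g z)}"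

definition multivalued_weighted_composition_operator ::
  "nat \<Rightarrow> (complex \<Rightarrow> complex) \<Rightarrow> (complex \<Rightarrow> complex) \<Rightarrow> (complex \<Rightarrow> complex) \<Rightarrow> fock_graph \<Rightarrow> bool"
where
  "multivalued_weighted_composition_operator m psi varphi phi S \<longleftrightarrow>
     multivalued_linear_operator S \<and> S \<subseteq> S_max m psi varphi phi"

definition wc_conjugation ::
  "complex \<Rightarrow> complex \<Rightarrow> complex \<Rightarrow> (complex \<Rightarrow> complex) \<Rightarrow> (complex \<Rightarrow> complex)" where
  "wc_conjugation a b c f = (\<lambda>z. c * exp (b * z) * cnj (f (cnj (a * z + b))))"

definition conj_adjoint ::
  "((complex \<Rightarrow> complex) \<Rightarrow> (complex \<Rightarrow> complex)) \<Rightarrow> fock_graph \<Rightarrow> fock_graph" where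
  "conj_adjoint \<C> G =
     {(u, v). u \<in> fock_space \<and> v \<in> fock_space \<and>
        (\<forall>(f, g)\<in>G. fock_inner g (\<C> u) = fock_inner f (\<C> v))}"

definition conj_selfadjoint ::
  "((complex \<Rightarrow> complex) \<Rightarrow> (complex \<Rightarrow> complex)) \<Rightarrow> fock_graph \<Rightarrow> bool" where
  "conj_selfadjoint \<C> G \<longleftrightarrow> conj_adjoint \<C> G = G"

text \<open>
  Equality of the quotients as meromorphic functions means equality off a closed discrete set
  of points, which contains the zeros of the denominators.
\<close>

definition equivalent_triples ::
  "(complex \<Rightarrow> complex) \<times> (complex \<Rightarrow> complex) \<times> (complex \<Rightarrow> complex) \<Rightarrow>
   (complex \<Rightarrow> complex) \<times> (complex \<Rightarrow> complex) \<times> (complex \<Rightarrow> complex) \<Rightarrow> bool" where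
  "equivalent_triples = (\<lambda>(psi, varphi, phi) (psi1, varphi1, phi1).
     psi holomorphic_on UNIV \<and> varphi holomorphic_on UNIV \<and> phi holomorphic_on UNIV \<and>
     psi1 holomorphic_on UNIV \<and> phi1 holomorphic_on UNIV \<and> varphi1 = varphi \<and>
     (\<exists>z. psi z \<noteq> 0) \<and> (\<exists>z. psi1 z \<noteq> 0) \<and>
     (\<forall>\<^sub>F z in cosparse UNIV. phi z / psi z = phi1 z / psi1 z))"

text \<open>
  For \<open>m \<ge> 1\<close> the characterisation of conjugation-selfadjointness fails when \<open>varphi\<close> is
  constant. With \<open>a = c = m = 1\<close>, \<open>b = 0\<close>, \<open>psi = varphi = 1\<close> and \<open>phi z = exp (- z)\<close>, we have
  \<open>exp z * phi z = psi z * 1 ^ m\<close>. However, \<open>S_max\<close> contains both \<open>(0, 1)\<close> and \<open>(z - 1, 0)\<close>,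
  and \<open>fock_inner (z - 1) 1 = - 1\<close> shows that \<open>(0, 1)\<close> is not in the adjoint of \<open>S_max\<close>.
  Hence the theorem is stated for \<open>m = 0\<close> or nonconstant \<open>varphi\<close>.
\<close>

end

theory Submission
  imports Defs "HOL-Probability.Distributions"
begin

text \<open>
  Write \<open>C\<close> for the conjugation, \<open>h = phi / psi\<close> (entire, because \<open>psi\<close> is zero free) and
  \<open>q z = (a * varphi z + b) ^ m\<close>, so that a pair \<open>(f, g)\<close> lies in the maximal graph iff
  \<open>f (varphi y) = h y * g\<^sup>(\<^sup>m\<^sup>) y\<close> for all \<open>y\<close>. Both sides of this equation are inner products with
  reproducing kernels: with \<open>K\<^sub>n\<^sub>,\<^sub>w z = z ^ n * exp (z * cnj w)\<close> the equation at \<open>y\<close> says exactly that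
  \<open>(f, g)\<close> is annihilated, in the sense of the \<open>C\<close>-adjoint, by the pair
  \<open>P y = (h y * C K\<^sub>m\<^sub>,\<^sub>y, C K\<^sub>0\<^sub>,\<^sub>w)\<close> with \<open>w = varphi y\<close>. Hence the maximal graph is the \<open>C\<close>-adjoint of the set of
  all \<open>P y\<close> (\<open>eq_graph_eq_adjoint\<close>), and every \<open>P y\<close> lies in the adjoint of every restriction of
  the maximal operator (\<open>kernel_pair_in_adjoint\<close>).

  Necessity. If \<open>S\<close> is \<open>C\<close>-selfadjoint, then each \<open>P y\<close> lies in the adjoint of \<open>S\<close>, which is \<open>S\<close>,
  so \<open>P y\<close> solves the defining equation itself. Written out, this is a functional equation in two
  variables that is symmetric in \<open>y\<close> and \<open>z\<close>. Freezing one variable shows that \<open>h\<close> is \<open>q\<close> times an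
  explicit exponential; inserting this back turns the equation into \<open>exp \<Theta> = 1\<close> for an entire
  \<open>\<Theta>\<close> that depends linearly on \<open>varphi\<close>, which forces \<open>varphi\<close> to be affine and then gives the formula
  for \<open>h\<close> (\<open>kernel_equation_solution\<close>). Maximality of \<open>S\<close> follows from the converse direction, since
  taking adjoints reverses inclusions.

  Sufficiency. Conversely the formulas make every \<open>P y\<close> a solution, so the adjoint of the maximal
  operator is contained in the maximal operator. What remains is the symmetry
  \<open>fock_inner v (C f) = fock_inner g (C u)\<close> for two solutions \<open>(f, g)\<close> and \<open>(u, v)\<close>; the operator may
  be unbounded, so it is not enough to check this on a dense set of functions. For constant
  \<open>varphi\<close> the operator has rank one and the symmetry is immediate. Otherwise the symmetry comes
  from an expansion of the inner product at an arbitrary point \<open>s\<close>: if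
  \<open>p z = cnj (H (cnj z) * exp (s * cnj z))\<close>, then formally
  \<open>fock_inner v p = (\<Sum>n. H\<^sup>(\<^sup>n\<^sup>) 0 / n! * v\<^sup>(\<^sup>n\<^sup>) s)\<close>, and this holds in the sense of Abel summation for
  all \<open>v\<close>, \<open>p\<close> in the Fock space (\<open>fock_inner_Abel_summation\<close>). For \<open>p = C f\<close> and \<open>s\<close> the zero of
  \<open>a * varphi + b\<close>, the defining equation turns \<open>H\<close> into a constant times
  \<open>w ^ m * g\<^sup>(\<^sup>m\<^sup>) (t * w + s)\<close>, so the series becomes \<open>\<Sum>n. M n * g\<^sup>(\<^sup>n\<^sup>) s * v\<^sup>(\<^sup>n\<^sup>) s / n!\<close> with
  coefficients \<open>M n\<close> that depend on neither pair. This is visibly symmetric in \<open>g\<close> and \<open>v\<close>.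
\<close>

section \<open>Gaussian integrals and isometries of the plane\<close>

text \<open>
  The invariance of Lebesgue measure under orthogonal maps is transported from \<open>real^2\<close>, to which
  the plane is identified by real and imaginary parts.
\<close>
lemma distr_lborel_linear_isometry:
  fixes f :: "complex \<Rightarrow> complex"
  assumes "linear f" and norm_f: "\<And>z. cmod (f z) = cmod z"
  shows "distr lborel borel f = lborel"
proof -
  define J :: "real^2 \<Rightarrow> complex" where "J x = Complex (x$1) (x$2)" for x
  define I :: "complex \<Rightarrow> real^2" where "I z = vector [Re z, Im z]" for z
  have JI [simp]: "J (I z) = z" and IJ [simp]: "I (J x) = x" for z x
    by (simp_all add: J_def I_def vec_eq_iff forall_2)
  have "linear J" "linear I"
    by (auto intro!: linearI simp: J_def I_def complex_eq_iff vec_eq_iff forall_2)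
  have norm_J: "norm (J x) = norm x" for x
    by (simp add: J_def norm_vec_def L2_set_def sum_2 cmod_def)
  have norm_I: "norm (I x) = norm x" for x
    by (metis JI norm_J)
  have [measurable]: "J \<in> borel_measurable borel" "I \<in> borel_measurable borel" "f \<in> borel_measurable borel"
    using \<open>linear J\<close> \<open>linear I\<close> \<open>linear f\<close>
    by (auto intro!: borel_measurable_continuous_onI linear_continuous_on
          simp: linear_conv_bounded_linear)
  have basis2: "(Basis :: (real^2) set) = {axis 1 1, axis 2 1}"
    by (auto simp: Basis_vec_def UNIV_2)
  have distr_J: "distr lborel borel J = lborel"
  proof (rule sym, rule lborel_eqI)
    fix l u :: complex assume lu: "\<And>b. b \<in> Basis \<Longrightarrow> l \<bullet> b \<le> u \<bullet> b"
    have "J -` box l u = box (I l) (I u)"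
      by (auto simp: box_def basis2 Basis_complex_def J_def I_def inner_axis)
    moreover have "Re l \<le> Re u" "Im l \<le> Im u"
      using lu[of 1] lu[of \<i>] by (auto simp: Basis_complex_def)
    ultimately show "emeasure (distr lborel borel J) (box l u) = (\<Prod>b\<in>Basis. (u - l) \<bullet> b)"
      by (subst emeasure_distr)
        (auto simp: emeasure_lborel_box_eq basis2 Basis_complex_def I_def inner_axis axis_eq_axis)
  qed simp
  define T where "T = I \<circ> f \<circ> J"
  have orth: "orthogonal_transformation T"
    unfolding orthogonal_transformation T_def
    using \<open>linear J\<close> \<open>linear I\<close> \<open>linear f\<close>
    by (auto intro!: linear_compose simp: norm_I norm_J norm_f)
  have [measurable]: "T \<in> borel_measurable borel"
    unfolding T_def comp_def by measurable
  have distr_T: "distr lborel borel T = lborel"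
  proof (rule sym, rule lborel_eqI)
    fix l u :: "real^2" assume lu: "\<And>b. b \<in> Basis \<Longrightarrow> l \<bullet> b \<le> u \<bullet> b"
    have img: "T -` box l u = inv T ` box l u"
      using orthogonal_transformation_bij[OF orth] by (simp add: bij_vimage_eq_inv_image)
    have inv: "orthogonal_transformation (inv T)"
      by (rule orthogonal_transformation_inv[OF orth])
    have "emeasure lebesgue (T -` box l u) = ennreal (measure lebesgue (inv T ` box l u))"
      unfolding img by (rule emeasure_eq_measure2[OF measurable_orthogonal_image[OF inv lmeasurable_box]])
    also have "\<dots> = emeasure lebesgue (box l u)"
      unfolding measure_orthogonal_image[OF inv lmeasurable_box]
      by (rule emeasure_eq_measure2[OF lmeasurable_box, symmetric])
    finally have "emeasure lebesgue (T -` box l u) = emeasure lebesgue (box l u)" .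
    moreover have "T -` box l u \<in> sets borel"
      using measurable_sets[of T borel borel "box l u"] by simp
    ultimately show "emeasure (distr lborel borel T) (box l u) = (\<Prod>b\<in>Basis. (u - l) \<bullet> b)"
      using lu by (simp add: emeasure_distr emeasure_lborel_box_eq)
  qed simp
  have "distr lborel borel f = distr (distr lborel borel J) borel f"
    by (simp add: distr_J)
  also have "\<dots> = distr lborel borel (f \<circ> J)"
    by (simp add: distr_distr)
  also have "f \<circ> J = J \<circ> T"
    by (auto simp: T_def)
  also have "distr lborel borel (J \<circ> T) = distr (distr lborel borel T) borel J"
    by (simp add: distr_distr)
  finally show ?thesis
    by (simp add: distr_T distr_J)
qed

lemma distr_lborel_rotation:
  assumes "cmod u = 1"
  shows "distr lborel borel (\<lambda>z. u * z) = lborel"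
  by (rule distr_lborel_linear_isometry) (auto intro!: linearI simp: algebra_simps norm_mult assms)

lemma distr_lborel_cnj: "distr lborel borel cnj = lborel"
  by (rule distr_lborel_linear_isometry) (auto intro!: linearI)

lemma
  fixes G :: "complex \<Rightarrow> 'a::{banach, second_countable_topology}"
  assumes T: "distr lborel borel T = lborel" "T \<in> borel_measurable borel" and G: "G \<in> borel_measurable borel"
  shows integral_measure_preserving: "(LINT z|lborel. G (T z)) = (LINT z|lborel. G z)"
    and integrable_measure_preserving: "integrable lborel (\<lambda>z. G (T z)) \<longleftrightarrow> integrable lborel G"
  using integral_distr[of T lborel borel G] integrable_distr_eq[of T lborel borel G] assms by auto

lemma integral_translation_complex:
  fixes G :: "complex \<Rightarrow> complex"
  assumes G: "G \<in> borel_measurable borel"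
  shows "(LINT z|lborel. G (w + z)) = (LINT z|lborel. G z)"
  by (rule integral_measure_preserving) (auto simp: assms lborel_distr_plus)

lemma
  fixes G :: "complex \<Rightarrow> real"
  assumes t: "t > 0" and G: "integrable lborel G"
  shows integrable_dilation: "integrable lborel (\<lambda>z. G (of_real t * z))"
    and integral_dilation: "(LINT z|lborel. G z) = t\<^sup>2 * (LINT z|lborel. G (of_real t * z))"
proof -
  have [measurable]: "G \<in> borel_measurable borel"
    using G by auto
  have lb: "lborel = density (distr lborel borel (\<lambda>z. of_real t * z :: complex)) (\<lambda>_. ennreal (t\<^sup>2))"
    using lborel_affine[of t "0::complex"] t by (simp add: scaleR_conv_of_real)
  show "integrable lborel (\<lambda>z. G (of_real t * z))"
    using G t by (subst (asm) lb) (simp add: integrable_density integrable_distr_eq)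
  show "(LINT z|lborel. G z) = t\<^sup>2 * (LINT z|lborel. G (of_real t * z))"
    using t by (subst lb) (simp add: integral_density integral_distr)
qed

lemma gaussian_nn_integral_complex:
  assumes "d > 0"
  shows "(\<integral>\<^sup>+z. ennreal (exp (- d * (cmod z)\<^sup>2)) \<partial>lborel) = ennreal (pi / d)"
proof -
  define s where "s = 1 / sqrt (2 * d)"
  have s: "s > 0" "s\<^sup>2 = 1 / (2 * d)"
    using assms by (auto simp: s_def power_divide)
  have eq: "exp (- d * x\<^sup>2) = sqrt (pi / d) * normal_density 0 s x" for x
    using assms by (simp add: normal_density_def s)
  have 1: "(\<integral>\<^sup>+x. ennreal (exp (- d * x\<^sup>2)) \<partial>lborel) = ennreal (sqrt (pi / d))"
    unfolding eq using assms s
    by (subst nn_integral_eq_integral) auto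
  have "(\<integral>\<^sup>+z. ennreal (exp (- d * (cmod z)\<^sup>2)) \<partial>lborel)
      = (\<integral>\<^sup>+z. (\<Prod>b\<in>Basis. ennreal (exp (- d * (z \<bullet> (b::complex))\<^sup>2))) \<partial>lborel)"
  proof (rule nn_integral_cong)
    fix z :: complex
    have "exp (- d * (cmod z)\<^sup>2) = exp (- d * (Re z)\<^sup>2) * exp (- d * (Im z)\<^sup>2)"
      unfolding exp_add[symmetric] by (simp add: cmod_power2 algebra_simps)
    then show "ennreal (exp (- d * (cmod z)\<^sup>2)) = (\<Prod>b\<in>Basis. ennreal (exp (- d * (z \<bullet> b)\<^sup>2)))"
      by (simp add: Basis_complex_def ennreal_mult)
  qed
  also have "\<dots> = (\<Prod>b\<in>(Basis :: complex set). (\<integral>\<^sup>+x. ennreal (exp (- d * x\<^sup>2)) \<partial>lborel))"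
    by (rule nn_integral_lborel_prod) auto
  also have "\<dots> = ennreal (pi / d)"
    unfolding 1 using assms by (simp add: Basis_complex_def flip: ennreal_mult)
  finally show ?thesis .
qed

lemma has_bochner_integral_gaussian_complex:
  assumes "d > 0"
  shows "has_bochner_integral lborel (\<lambda>z. exp (- d * (cmod z)\<^sup>2)) (pi / d)"
  using gaussian_nn_integral_complex[OF assms] assms
  by (intro has_bochner_integral_nn_integral) auto

text \<open>
  A linear term in the exponent is absorbed by half of the quadratic one.
\<close>
lemma integrable_gaussian_dominated:
  fixes f :: "complex \<Rightarrow> 'a::{banach, second_countable_topology}"
  assumes "f \<in> borel_measurable borel" "d > 0"
    and le: "\<And>z. norm (f z) \<le> K * exp (c * cmod z - d * (cmod z)\<^sup>2)"
  shows "integrable lborel f"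
proof (rule Bochner_Integration.integrable_bound)
  show "integrable lborel (\<lambda>z. \<bar>K\<bar> * exp (c\<^sup>2 / (2 * d)) * exp (- (d / 2) * (cmod z)\<^sup>2))"
    using has_bochner_integral_gaussian_complex[of "d / 2"] assms(2)
    by (intro integrable_mult_right) (auto simp: has_bochner_integral_iff)
  show "f \<in> borel_measurable lborel" using assms(1) by simp
  have "norm (f z) \<le> norm (\<bar>K\<bar> * exp (c\<^sup>2 / (2 * d)) * exp (- (d / 2) * (cmod z)\<^sup>2))" for z
  proof -
    have "0 \<le> (d * cmod z - c)\<^sup>2" by simp
    then have "c * cmod z - d * (cmod z)\<^sup>2 \<le> c\<^sup>2 / (2 * d) + - (d / 2) * (cmod z)\<^sup>2"
      using assms(2) by (simp add: power2_eq_square field_simps)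
    then have "exp (c * cmod z - d * (cmod z)\<^sup>2) \<le> exp (c\<^sup>2 / (2 * d)) * exp (- (d / 2) * (cmod z)\<^sup>2)"
      by (simp flip: exp_add)
    then have "\<bar>K\<bar> * exp (c * cmod z - d * (cmod z)\<^sup>2) \<le> \<bar>K\<bar> * (exp (c\<^sup>2 / (2 * d)) * exp (- (d / 2) * (cmod z)\<^sup>2))"
      by (rule mult_left_mono) simp
    moreover have "norm (f z) \<le> \<bar>K\<bar> * exp (c * cmod z - d * (cmod z)\<^sup>2)"
      by (rule order_trans[OF le]) (auto intro: mult_right_mono)
    ultimately show ?thesis by (simp add: abs_mult mult.assoc)
  qed
  then show "AE z in lborel. norm (f z) \<le> norm (\<bar>K\<bar> * exp (c\<^sup>2 / (2 * d)) * exp (- (d / 2) * (cmod z)\<^sup>2))"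
    by simp
qed

text \<open>
  This is Cauchy's integral formula on the unit circle, for \<open>u \<mapsto> x (u * z)\<close> at the centre.
\<close>
lemma circle_average:
  assumes "x holomorphic_on UNIV"
  shows "((\<lambda>s. x (exp (2 * of_real pi * \<i> * of_real s) * z)) has_integral x 0) {0..1}"
proof -
  have "((\<lambda>u. x (u * z) / (u - 0)) has_contour_integral (2 * of_real pi * \<i> * x (0 * z))) (circlepath 0 1)"
    by (rule Cauchy_integral_circlepath_simple)
      (auto intro!: holomorphic_intros holomorphic_on_compose_gen[of _ _ x UNIV, unfolded o_def] assms)
  then have "((\<lambda>s. x (exp (2 * of_real pi * \<i> * of_real s) * z) / exp (2 * of_real pi * \<i> * of_real s)
      * (2 * pi * \<i> * exp (2 * of_real pi * \<i> * of_real s))) has_integral 2 * of_real pi * \<i> * x 0) {0..1}"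
    unfolding has_contour_integral_def
    by (subst (asm) has_integral_cong[where g = "\<lambda>s. x (exp (2 * of_real pi * \<i> * of_real s) * z) / exp (2 * of_real pi * \<i> * of_real s)
      * (2 * pi * \<i> * exp (2 * of_real pi * \<i> * of_real s))"])
      (auto simp: vector_derivative_circlepath01 circlepath[unfolded fun_eq_iff] mult_ac)
  then have "((\<lambda>s. (2 * of_real pi * \<i>) * x (exp (2 * of_real pi * \<i> * of_real s) * z)) has_integral (2 * of_real pi * \<i>) * x 0) {0..1}"
    by (simp add: field_simps)
  from has_integral_mult_right[OF this, of "1 / (2 * of_real pi * \<i>)"]
  show ?thesis by simp
qed

text \<open>
  The Gaussian measure is invariant under rotations, so \<open>x\<close> may be replaced by its average over
  circles around the origin, which is the constant \<open>x 0\<close>.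
\<close>
lemma gaussian_mean_value:
  assumes hol: "x holomorphic_on UNIV"
    and int: "integrable lborel (\<lambda>z. x z * of_real (exp (- (cmod z)\<^sup>2)))"
  shows "(LINT z|lborel. x z * of_real (exp (- (cmod z)\<^sup>2))) = of_real pi * x 0"
proof -
  define e where "e s = exp (2 * of_real pi * \<i> * of_real s)" for s :: real
  define G where "G z = x z * of_real (exp (- (cmod z)\<^sup>2))" for z
  have norm_e: "cmod (e s) = 1" for s
    by (simp add: e_def)
  have cont_x: "continuous_on A x" for A
    using hol holomorphic_on_imp_continuous_on continuous_on_subset by blast
  have cont_G: "continuous_on A G" for A
    unfolding G_def by (intro continuous_intros cont_x)
  have [measurable]: "G \<in> borel_measurable borel" "e \<in> borel_measurable borel"
    unfolding e_def
    by (auto intro!: borel_measurable_continuous_onI cont_G continuous_intros)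
  have rot: "(LINT z|lborel. F (e s * z)) = (LINT z|lborel. F z)"
      "integrable lborel (\<lambda>z. F (e s * z)) \<longleftrightarrow> integrable lborel F"
    if "F \<in> borel_measurable borel" for F :: "complex \<Rightarrow> 'b::{banach, second_countable_topology}" and s
    by (rule integral_measure_preserving integrable_measure_preserving; simp add: distr_lborel_rotation norm_e that)+
  have avg: "(LINT s|lborel. indicator {0..1} s *\<^sub>R G (e s * z)) = x 0 * of_real (exp (- (cmod z)\<^sup>2))" for z
  proof -
    have "set_integrable lborel {0..1} (\<lambda>s. G (e s * z))"
      unfolding e_def
      by (intro borel_integrable_atLeastAtMost' continuous_intros continuous_on_compose2[OF cont_G[of UNIV]]) auto
    then have "(LINT s:{0..1}|lborel. G (e s * z)) = integral {0..1} (\<lambda>s. G (e s * z))"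
      by (rule set_borel_integral_eq_integral)
    also have "\<dots> = integral {0..1} (\<lambda>s. x (e s * z) * of_real (exp (- (cmod z)\<^sup>2)))"
      by (simp add: G_def norm_mult norm_e)
    also have "\<dots> = x 0 * of_real (exp (- (cmod z)\<^sup>2))"
      unfolding e_def by (intro integral_unique has_integral_mult_left circle_average hol)
    finally show ?thesis by (simp add: set_lebesgue_integral_def)
  qed
  have meas: "(\<lambda>(s, z). indicator {0..1::real} s *\<^sub>R G (e s * z)) \<in> borel_measurable (lborel \<Otimes>\<^sub>M lborel)"
    unfolding case_prod_beta by measurable
  have prod: "integrable (lborel \<Otimes>\<^sub>M lborel) (\<lambda>(s, z). indicator {0..1::real} s *\<^sub>R G (e s * z))"
  proof (rule lborel_pair.Fubini_integrable[OF meas], goal_cases)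
    case 1
    have "(LINT z|lborel. norm (G (e s * z))) = (LINT z|lborel. norm (G z))" for s
      by (subst rot(1)[of "\<lambda>z. norm (G z)"]) auto
    then show ?case
      by simp
  next
    case 2
    have "integrable lborel (\<lambda>z. G (e s * z))" for s
      using int by (simp only: rot G_def[abs_def, symmetric] \<open>G \<in> borel_measurable borel\<close>)
    then show ?case
      by (intro AE_I2) (simp)
  qed
  have "(LINT z|lborel. G z) = (LINT s|lborel. indicator {0..1::real} s *\<^sub>R (LINT z|lborel. G z))"
    by simp
  also have "\<dots> = (LINT s|lborel. LINT z|lborel. indicator {0..1::real} s *\<^sub>R G (e s * z))"
    by (simp add: rot)
  also have "\<dots> = (LINT z|lborel. LINT s|lborel. indicator {0..1::real} s *\<^sub>R G (e s * z))"
    by (rule lborel_pair.Fubini_integral[symmetric, OF prod])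
  also have "\<dots> = x 0 * (LINT z|lborel. complex_of_real (exp (- (cmod z)\<^sup>2)))"
    by (simp add: avg)
  also have "(LINT z|lborel. complex_of_real (exp (- (cmod z)\<^sup>2))) = of_real pi"
    using has_bochner_integral_gaussian_complex[of 1] by (simp add: has_bochner_integral_iff)
  finally show ?thesis by (simp add: G_def mult.commute)
qed

section \<open>Fock space and its reproducing kernel\<close>

lemma entire_continuous_on: "f holomorphic_on UNIV \<Longrightarrow> continuous_on A f"
  using holomorphic_on_imp_continuous_on continuous_on_subset by blast

lemma entire_borel_measurable: "f holomorphic_on UNIV \<Longrightarrow> f \<in> borel_measurable borel"
  by (intro borel_measurable_continuous_onI entire_continuous_on)

lemma entire_compose_affine:
  assumes "f holomorphic_on UNIV"
  shows "(\<lambda>z. f (u * z + w)) holomorphic_on UNIV"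
  by (rule holomorphic_on_compose_gen[OF _ assms, unfolded o_def]) (auto intro!: holomorphic_intros)

lemma fock_spaceD:
  assumes "f \<in> fock_space"
  shows "f holomorphic_on UNIV" "f \<in> borel_measurable borel"
    "integrable lborel (\<lambda>z. (cmod (f z))\<^sup>2 * exp (- (cmod z)\<^sup>2))"
  using assms entire_borel_measurable by (auto simp: fock_space_def)

lemma fock_spaceI_growth:
  assumes hol: "f holomorphic_on UNIV" and "d < 1 / 2"
    and le: "\<And>z. cmod (f z) \<le> K * exp (c * cmod z + d * (cmod z)\<^sup>2)"
  shows "f \<in> fock_space"
proof -
  have "integrable lborel (\<lambda>z. (cmod (f z))\<^sup>2 * exp (- (cmod z)\<^sup>2))"
  proof (rule integrable_gaussian_dominated)
    show "(\<lambda>z. (cmod (f z))\<^sup>2 * exp (- (cmod z)\<^sup>2)) \<in> borel_measurable borel"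
      using entire_borel_measurable[OF hol] by measurable
    show "0 < 1 - 2 * d" using assms by simp
    fix z
    have "(cmod (f z))\<^sup>2 \<le> (K * exp (c * cmod z + d * (cmod z)\<^sup>2))\<^sup>2"
      by (intro power_mono le) auto
    also have "\<dots> = K\<^sup>2 * exp (2 * (c * cmod z + d * (cmod z)\<^sup>2))"
      by (simp add: power_mult_distrib flip: exp_double)
    finally have "(cmod (f z))\<^sup>2 * exp (- (cmod z)\<^sup>2)
        \<le> K\<^sup>2 * exp (2 * (c * cmod z + d * (cmod z)\<^sup>2)) * exp (- (cmod z)\<^sup>2)"
      by (rule mult_right_mono) simp
    also have "\<dots> = K\<^sup>2 * exp (2 * c * cmod z - (1 - 2 * d) * (cmod z)\<^sup>2)"
      by (simp add: algebra_simps flip: exp_add)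
    finally show "norm ((cmod (f z))\<^sup>2 * exp (- (cmod z)\<^sup>2)) \<le> K\<^sup>2 * exp ((2 * c) * cmod z - (1 - 2 * d) * (cmod z)\<^sup>2)"
      by simp
  qed
  then show ?thesis using hol by (simp add: fock_space_def)
qed

lemma fock_space_power_exp: "(\<lambda>z. z ^ n * exp (z * w)) \<in> fock_space"
proof (rule fock_spaceI_growth)
  show "(\<lambda>z. z ^ n * exp (z * w)) holomorphic_on UNIV"
    by (intro holomorphic_intros)
  show "(0::real) < 1 / 2" by simp
  fix z :: complex
  have "cmod z ^ n / fact n \<le> (\<Sum>k. cmod z ^ k /\<^sub>R fact k)"
    using sum_le_suminf[OF summable_exp_generic[of "cmod z"], of "{n}"] by (simp add: field_simps)
  then have "cmod z ^ n \<le> fact n * exp (cmod z)"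
    by (simp add: exp_def field_simps)
  moreover have "Re (z * w) \<le> cmod w * cmod z"
    by (metis complex_Re_le_cmod mult.commute norm_mult)
  ultimately have "cmod z ^ n * exp (Re (z * w)) \<le> (fact n * exp (cmod z)) * exp (cmod w * cmod z)"
    by (intro mult_mono) auto
  also have "\<dots> = fact n * exp ((1 + cmod w) * cmod z + 0 * (cmod z)\<^sup>2)"
    by (simp add: algebra_simps exp_add)
  finally show "cmod (z ^ n * exp (z * w)) \<le> fact n * exp ((1 + cmod w) * cmod z + 0 * (cmod z)\<^sup>2)"
    by (simp add: norm_mult norm_power)
qed

lemma fock_space_exp: "(\<lambda>z. exp (z * w)) \<in> fock_space"
  using fock_space_power_exp[of 0 w] by simp

lemma fock_space_cmult: "f \<in> fock_space \<Longrightarrow> (\<lambda>z. k * f z) \<in> fock_space"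
  by (auto simp: fock_space_def norm_mult power_mult_distrib mult.assoc intro!: holomorphic_intros)

lemma integrable_fock_inner:
  assumes "f \<in> fock_space" "g \<in> fock_space"
  shows "integrable lborel (\<lambda>z. f z * cnj (g z) * of_real (exp (- (cmod z)\<^sup>2)))"
proof (rule Bochner_Integration.integrable_bound)
  show "integrable lborel (\<lambda>z. (cmod (f z))\<^sup>2 * exp (- (cmod z)\<^sup>2) + (cmod (g z))\<^sup>2 * exp (- (cmod z)\<^sup>2))"
    using assms by (intro Bochner_Integration.integrable_add fock_spaceD)
  show "(\<lambda>z. f z * cnj (g z) * of_real (exp (- (cmod z)\<^sup>2))) \<in> borel_measurable lborel"
    unfolding measurable_lborel2
    by (intro borel_measurable_continuous_onI continuous_on_mult continuous_on_cnj continuous_on_of_real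
        continuous_on_exp continuous_on_minus continuous_on_power continuous_on_norm continuous_on_id
        entire_continuous_on[OF fock_spaceD(1)[OF assms(1)]] entire_continuous_on[OF fock_spaceD(1)[OF assms(2)]])
  have "cmod (f z) * cmod (g z) \<le> (cmod (f z))\<^sup>2 + (cmod (g z))\<^sup>2" for z
    using sum_squares_bound[of "cmod (f z)" "cmod (g z)"] mult_nonneg_nonneg[OF norm_ge_zero norm_ge_zero, of "f z" "g z"]
    by linarith
  then have "cmod (f z) * cmod (g z) * exp (- (cmod z)\<^sup>2)
      \<le> (cmod (f z))\<^sup>2 * exp (- (cmod z)\<^sup>2) + (cmod (g z))\<^sup>2 * exp (- (cmod z)\<^sup>2)" for z
    by (simp flip: distrib_right)
  then show "AE z in lborel. norm (f z * cnj (g z) * of_real (exp (- (cmod z)\<^sup>2)))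
      \<le> norm ((cmod (f z))\<^sup>2 * exp (- (cmod z)\<^sup>2) + (cmod (g z))\<^sup>2 * exp (- (cmod z)\<^sup>2))"
    by (simp add: norm_mult)
qed

lemma fock_inner_cmult_left: "fock_inner (\<lambda>z. k * f z) g = k * fock_inner f g"
  unfolding fock_inner_def by (simp add: mult.assoc)

lemma of_real_gaussian: "complex_of_real (exp (- (cmod z)\<^sup>2)) = exp (- (z * cnj z))"
  by (metis complex_norm_square exp_of_real of_real_minus)

text \<open>
  Translation by \<open>w\<close> reduces the claim to the mean value property at the origin: the exponential
  produced by the shifted Gaussian cancels the antiholomorphic factor of the kernel.
\<close>
lemma reproducing_kernel:
  assumes f: "f \<in> fock_space"
  shows "fock_inner f (\<lambda>z. exp (z * cnj w)) = f w"
proof -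
  define G where "G z = f z * cnj (exp (z * cnj w)) * of_real (exp (- (cmod z)\<^sup>2))" for z
  have [measurable]: "G \<in> borel_measurable borel"
    unfolding G_def
    by (intro borel_measurable_continuous_onI continuous_intros entire_continuous_on[OF fock_spaceD(1)[OF f]])
  have shift: "G (w + z) = (f (w + z) * exp (- (z * cnj w))) * of_real (exp (- (cmod z)\<^sup>2))" for z
    unfolding G_def of_real_gaussian exp_cnj mult.assoc exp_add[symmetric]
    by (simp add: algebra_simps)
  have int: "integrable lborel G"
    unfolding G_def using integrable_fock_inner[OF f fock_space_exp] .
  then have "integrable lborel (\<lambda>z. G (w + z))"
    by (subst integrable_measure_preserving) (auto simp: lborel_distr_plus)
  then have "(LINT z|lborel. (f (w + z) * exp (- (z * cnj w))) * of_real (exp (- (cmod z)\<^sup>2)))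
      = of_real pi * (f (w + 0) * exp (- (0 * cnj w)))"
    unfolding shift
    by (intro gaussian_mean_value)
      (use entire_compose_affine[OF fock_spaceD(1)[OF f], of 1 w] in \<open>auto intro!: holomorphic_intros simp: add.commute\<close>)
  moreover have "(LINT z|lborel. G z) = (LINT z|lborel. G (w + z))"
    by (simp add: integral_translation_complex)
  ultimately show ?thesis
    unfolding shift by (simp add: fock_inner_def G_def)
qed

text \<open>
  The Cauchy-Schwarz bound for \<open>f w = fock_inner f K\<close> with \<open>K z = exp (z * cnj w)\<close>, whose squared norm
  is \<open>K w = exp (\<bar>w\<bar>\<^sup>2)\<close>. As only the growth rate matters, Cauchy-Schwarz is replaced by the
  arithmetic-geometric mean inequality, weighted so that both terms grow like \<open>exp (\<bar>w\<bar>\<^sup>2 / 2)\<close>.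
\<close>
lemma fock_pointwise_bound:
  assumes f: "f \<in> fock_space"
  obtains K where "\<And>z. cmod (f z) \<le> K * exp ((cmod z)\<^sup>2 / 2)"
proof
  fix w :: complex
  \<comment> \<open>the norm of the kernel at \<open>w\<close>, used as the weight\<close>
  define E where "E = exp ((cmod w)\<^sup>2 / 2)"
  define k where "k z = exp (z * cnj w)" for z
  have k: "k \<in> fock_space"
    unfolding k_def by (rule fock_space_exp)
  have "complex_of_real (LINT z|lborel. (cmod (k z))\<^sup>2 * exp (- (cmod z)\<^sup>2))
      = (LINT z|lborel. k z * cnj (k z) * of_real (exp (- (cmod z)\<^sup>2)))"
    by (simp flip: complex_norm_square integral_complex_of_real)
  also have "\<dots> = of_real pi * fock_inner k k"
    by (simp add: fock_inner_def)
  also have "fock_inner k k = k w"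
    using reproducing_kernel[OF k, of w] unfolding k_def .
  also have "k w = of_real (exp ((cmod w)\<^sup>2))"
    unfolding k_def by (metis complex_norm_square exp_of_real)
  finally have kk: "(LINT z|lborel. (cmod (k z))\<^sup>2 * exp (- (cmod z)\<^sup>2)) = pi * exp ((cmod w)\<^sup>2)"
    by (simp only: of_real_mult[symmetric] of_real_eq_iff)
  let ?N = "LINT z|lborel. (cmod (f z))\<^sup>2 * exp (- (cmod z)\<^sup>2)"
  have E: "E > 0" "exp ((cmod w)\<^sup>2) = E * E"
    by (auto simp: E_def simp flip: exp_add)
  have "pi * cmod (f w) = cmod (LINT z|lborel. f z * cnj (k z) * of_real (exp (- (cmod z)\<^sup>2)))"
    using reproducing_kernel[OF f, of w] by (simp add: fock_inner_def k_def norm_divide norm_mult field_simps)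
  also have "\<dots> \<le> (LINT z|lborel. norm (f z * cnj (k z) * of_real (exp (- (cmod z)\<^sup>2))))"
    by (rule integral_norm_bound)
  also have "\<dots> \<le> (LINT z|lborel. E * ((cmod (f z))\<^sup>2 * exp (- (cmod z)\<^sup>2)) + (cmod (k z))\<^sup>2 * exp (- (cmod z)\<^sup>2) / E)"
  proof (rule integral_mono)
    show "integrable lborel (\<lambda>z. norm (f z * cnj (k z) * of_real (exp (- (cmod z)\<^sup>2))))"
      by (intro integrable_norm integrable_fock_inner f k)
    show "integrable lborel (\<lambda>z. E * ((cmod (f z))\<^sup>2 * exp (- (cmod z)\<^sup>2)) + (cmod (k z))\<^sup>2 * exp (- (cmod z)\<^sup>2) / E)"
      using fock_spaceD(3)[OF f] fock_spaceD(3)[OF k] by auto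
    fix z
    have "2 * (E * cmod (f z)) * cmod (k z) \<le> (E * cmod (f z))\<^sup>2 + (cmod (k z))\<^sup>2"
      by (rule sum_squares_bound)
    moreover have "0 \<le> E * cmod (f z) * cmod (k z)"
      using E by simp
    moreover have "E * (E * (cmod (f z))\<^sup>2 + (cmod (k z))\<^sup>2 / E) = (E * cmod (f z))\<^sup>2 + (cmod (k z))\<^sup>2"
      using E(1) by (simp add: algebra_simps power2_eq_square)
    ultimately have "E * (cmod (f z) * cmod (k z)) \<le> E * (E * (cmod (f z))\<^sup>2 + (cmod (k z))\<^sup>2 / E)"
      by (simp add: mult.assoc)
    then have "cmod (f z) * cmod (k z) \<le> E * (cmod (f z))\<^sup>2 + (cmod (k z))\<^sup>2 / E"
      using E by simp
    then have "cmod (f z) * cmod (k z) * exp (- (cmod z)\<^sup>2) \<le> (E * (cmod (f z))\<^sup>2 + (cmod (k z))\<^sup>2 / E) * exp (- (cmod z)\<^sup>2)"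
      by (rule mult_right_mono) simp
    then show "norm (f z * cnj (k z) * of_real (exp (- (cmod z)\<^sup>2)))
        \<le> E * ((cmod (f z))\<^sup>2 * exp (- (cmod z)\<^sup>2)) + (cmod (k z))\<^sup>2 * exp (- (cmod z)\<^sup>2) / E"
      by (simp add: norm_mult algebra_simps)
  qed
  also have "\<dots> = E * ?N + pi * (E * E) / E"
    using fock_spaceD(3)[OF f] fock_spaceD(3)[OF k] by (simp add: kk E)
  also have "\<dots> = (?N + pi) * E"
    using E by (simp add: algebra_simps)
  finally show "cmod (f w) \<le> (?N + pi) / pi * exp ((cmod w)\<^sup>2 / 2)"
    by (simp add: E_def field_simps)
qed

text \<open>
  Cauchy's estimates on the circle of radius \<open>l * \<bar>w\<bar>\<close> make the Taylor terms at \<open>w\<close> decay like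
  \<open>(1 / l) ^ n\<close>, so the partial sums are controlled by the values of \<open>H\<close> on a slightly larger disc,
  uniformly in their length.
\<close>
lemma entire_Taylor_partial_sum_bound:
  assumes hol: "H holomorphic_on UNIV" and l: "1 < l"
    and bound: "\<And>u. cmod u \<le> l * cmod w \<Longrightarrow> cmod (H u) \<le> B"
  shows "cmod (\<Sum>n<N. (deriv ^^ n) H 0 / fact n * w ^ n) \<le> l / (l - 1) * B"
proof -
  have B: "0 \<le> B"
    using order_trans[OF norm_ge_zero bound[of 0]] l by simp
  have coeff: "cmod ((deriv ^^ n) H 0 / fact n * w ^ n) \<le> B * (1 / l) ^ n" for n
  proof (cases "w = 0")
    case True
    then show ?thesis using bound[of 0] l B by (cases n) auto
  next
    case False
    have "cmod ((deriv ^^ n) H 0) \<le> fact n * B / (l * cmod w) ^ n"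
      using l False
      by (intro Cauchy_inequality)
        (auto intro: holomorphic_on_subset[OF hol] entire_continuous_on[OF hol] bound)
    then have "cmod ((deriv ^^ n) H 0) / fact n * cmod w ^ n
        \<le> (fact n * B / (l * cmod w) ^ n) / fact n * cmod w ^ n"
      by (intro mult_right_mono divide_right_mono) auto
    also have "\<dots> = B * (1 / l) ^ n"
      using False by (simp add: power_mult_distrib field_simps)
    finally show ?thesis by (simp add: norm_mult norm_divide norm_power)
  qed
  have "cmod (\<Sum>n<N. (deriv ^^ n) H 0 / fact n * w ^ n) \<le> (\<Sum>n<N. B * (1 / l) ^ n)"
    by (intro sum_norm_le coeff)
  also have "\<dots> \<le> (\<Sum>n. B * (1 / l) ^ n)"
    using l B by (intro sum_le_suminf summable_mult summable_geometric) auto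
  also have "\<dots> = B * (1 / (1 - 1 / l))"
    using l by (subst suminf_mult) (auto simp: suminf_geometric intro!: summable_geometric)
  also have "\<dots> = l / (l - 1) * B"
    using l by (simp add: field_simps)
  finally show ?thesis .
qed

text \<open>
  The Taylor series of \<open>H\<close> may be integrated term by term: its growth \<open>d < 1 / 2\<close> leaves room for the
  factor \<open>l > 1\<close> in the bound on the partial sums, which then have an integrable majorant together
  with \<open>\<bar>f z\<bar> \<le> F * exp (\<bar>z\<bar>\<^sup>2 / 2)\<close>.
\<close>
lemma fock_inner_power_series_sums:
  assumes f: "f \<in> fock_space" and H: "H holomorphic_on UNIV"
    and d: "0 < d" "d < 1 / 2" and c: "0 \<le> c" and K: "0 \<le> K"
    and bound: "\<And>u. cmod (H u) \<le> K * exp (c * cmod u + d * (cmod u)\<^sup>2)"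
  shows "(\<lambda>n. (deriv ^^ n) H 0 / fact n * fock_inner f (\<lambda>z. z ^ n * exp (z * cnj s)))
    sums fock_inner f (\<lambda>z. cnj (H (cnj z) * exp (s * cnj z)))"
proof -
  define W where "W z = f z * exp (s * cnj z) * of_real (exp (- (cmod z)\<^sup>2))" for z
  define T where "T N u = (\<Sum>n<N. (deriv ^^ n) H 0 / fact n * u ^ n)" for N u
  \<comment> \<open>any \<open>l > 1\<close> with \<open>d * l\<^sup>2 < 1 / 2\<close> would do; here \<open>d * l\<^sup>2\<close> is half the square root of \<open>2 * d\<close>\<close>
  define l where "l = sqrt (1 / sqrt (2 * d))"
  have l: "1 < l" "d * l\<^sup>2 < 1 / 2"
  proof -
    define q where "q = sqrt (2 * d)"
    have q: "0 < q" "q < 1" "d = q * q / 2" using d by (auto simp: q_def)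
    then show "1 < l" by (simp add: l_def flip: q_def)
    show "d * l\<^sup>2 < 1 / 2"
      using q by (simp add: l_def flip: q_def)
  qed
  obtain F where F: "\<And>z. cmod (f z) \<le> F * exp ((cmod z)\<^sup>2 / 2)"
    using fock_pointwise_bound[OF f] by blast
  have F0: "0 \<le> F"
    using order_trans[OF norm_ge_zero F[of 0]] by simp
  have T_lim: "(\<lambda>N. T N u) \<longlonglongrightarrow> H u" for u
    using holomorphic_power_series[of H 0 "cmod u + 1" u] holomorphic_on_subset[OF H]
    by (simp add: T_def sums_def)
  have T_bound: "cmod (T N u) \<le> l / (l - 1) * (K * exp (c * (l * cmod u) + d * (l * cmod u)\<^sup>2))" for N u
    unfolding T_def
  proof (rule entire_Taylor_partial_sum_bound[OF H l(1)])
    fix v assume v: "cmod v \<le> l * cmod u"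
    have "cmod (H v) \<le> K * exp (c * cmod v + d * (cmod v)\<^sup>2)"
      by (rule bound)
    also have "\<dots> \<le> K * exp (c * (l * cmod u) + d * (l * cmod u)\<^sup>2)"
      using v c d K by (intro mult_left_mono iffD2[OF exp_le_cancel_iff] add_mono power_mono) auto
    finally show "cmod (H v) \<le> K * exp (c * (l * cmod u) + d * (l * cmod u)\<^sup>2)" .
  qed
  have cont_f: "continuous_on UNIV f" and cont_H: "continuous_on UNIV H"
    using fock_spaceD(1)[OF f] H by (auto intro: entire_continuous_on)
  define w where "w z = l / (l - 1) * K * F * exp ((c * l + cmod s) * cmod z - (1 / 2 - d * l\<^sup>2) * (cmod z)\<^sup>2)" for z
  have int_w: "integrable lborel w"
    unfolding w_def
    by (rule integrable_gaussian_dominated[where K = "l / (l - 1) * K * F" and c = "c * l + cmod s" and d = "1 / 2 - d * l\<^sup>2"])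
      (use l K F0 in auto)
  have dom: "cmod (T N (cnj z) * W z) \<le> w z" for N z
  proof -
    have "cmod (W z) = cmod (f z) * exp (Re (s * cnj z)) * exp (- (cmod z)\<^sup>2)"
      by (simp add: W_def norm_mult)
    also have "\<dots> \<le> (F * exp ((cmod z)\<^sup>2 / 2)) * exp (cmod s * cmod z) * exp (- (cmod z)\<^sup>2)"
      using F[of z] F0 complex_Re_le_cmod[of "s * cnj z"]
      by (intro mult_mono) (auto simp: norm_mult)
    finally have W: "cmod (W z) \<le> (F * exp ((cmod z)\<^sup>2 / 2)) * exp (cmod s * cmod z) * exp (- (cmod z)\<^sup>2)" .
    have "cmod (T N (cnj z) * W z) \<le> (l / (l - 1) * (K * exp (c * (l * cmod z) + d * (l * cmod z)\<^sup>2)))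
        * ((F * exp ((cmod z)\<^sup>2 / 2)) * exp (cmod s * cmod z) * exp (- (cmod z)\<^sup>2))"
      unfolding norm_mult using T_bound[of N "cnj z"] W K l by (intro mult_mono) auto
    also have "\<dots> = l / (l - 1) * K * F * (exp (c * (l * cmod z) + d * (l * cmod z)\<^sup>2)
        * exp ((cmod z)\<^sup>2 / 2) * exp (cmod s * cmod z) * exp (- (cmod z)\<^sup>2))"
      by (simp only: mult_ac)
    also have "\<dots> = w z"
      unfolding w_def exp_add[symmetric] by (simp add: algebra_simps power_mult_distrib)
    finally show ?thesis .
  qed
  have meas: "(\<lambda>z. T N (cnj z) * W z) \<in> borel_measurable lborel" "(\<lambda>z. H (cnj z) * W z) \<in> borel_measurable lborel" for N
    unfolding T_def W_def
    by (subst measurable_lborel2, intro borel_measurable_continuous_onI continuous_intros cont_f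
        continuous_on_compose2[OF cont_H]; simp)+
  have lim: "(\<lambda>N. LINT z|lborel. T N (cnj z) * W z) \<longlonglongrightarrow> (LINT z|lborel. H (cnj z) * W z)"
    by (rule integral_dominated_convergence[OF meas(2) meas(1) int_w])
      (auto intro!: AE_I2 tendsto_intros T_lim dom)
  have sum: "(LINT z|lborel. T N (cnj z) * W z)
      = (\<Sum>n<N. (deriv ^^ n) H 0 / fact n * (LINT z|lborel. cnj z ^ n * W z))" for N
  proof -
    have "integrable lborel (\<lambda>z. cnj z ^ n * W z)" for n
      using integrable_fock_inner[OF f fock_space_power_exp[of n "cnj s"]]
      by (simp add: W_def exp_cnj mult_ac)
    then show ?thesis
      by (simp add: T_def sum_distrib_right mult.assoc)
  qed
  have lhs: "fock_inner f (\<lambda>z. z ^ n * exp (z * cnj s)) = 1 / of_real pi * (LINT z|lborel. cnj z ^ n * W z)" for n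
    by (simp add: fock_inner_def W_def exp_cnj mult_ac)
  have rhs: "fock_inner f (\<lambda>z. cnj (H (cnj z) * exp (s * cnj z))) = 1 / of_real pi * (LINT z|lborel. H (cnj z) * W z)"
    by (simp add: fock_inner_def W_def mult_ac)
  have "(\<lambda>n. (deriv ^^ n) H 0 / fact n * (LINT z|lborel. cnj z ^ n * W z)) sums (LINT z|lborel. H (cnj z) * W z)"
    using lim by (simp only: sum sums_def)
  from sums_mult[OF this, of "1 / of_real pi"] show ?thesis
    unfolding lhs rhs by (simp only: mult.left_commute)
qed

lemma power_series_coeff_unique:
  fixes a :: "nat \<Rightarrow> complex"
  assumes "\<And>u. (\<lambda>n. a n * u ^ n) sums F u"
  shows "a n = (deriv ^^ n) F 0 / fact n"
proof -
  have "ereal 1 \<le> conv_radius a"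
    using conv_radius_geI[of a "1::complex"] sums_summable[OF assms[of 1]] by simp
  then have "0 < fps_conv_radius (Abs_fps a)"
    by (simp add: fps_conv_radius_def less_le_trans[of 0 "ereal 1"])
  moreover have "eval_fps (Abs_fps a) = F"
    using sums_unique[OF assms] by (auto simp: eval_fps_def)
  ultimately have "F has_fps_expansion Abs_fps a"
    by (simp add: has_fps_expansion_def)
  then show ?thesis
    by (metis fps_nth_Abs_fps fps_nth_fps_expansion)
qed

lemma higher_deriv_exp_linear:
  "(deriv ^^ n) (\<lambda>z. k * exp (u * z)) = (\<lambda>z. k * u ^ n * exp (u * z :: complex))"
proof (induction n)
  case (Suc n)
  have "deriv (\<lambda>z. k * u ^ n * exp (u * z)) z = k * u ^ Suc n * exp (u * z)" for z
    by (rule DERIV_imp_deriv) (auto intro!: derivative_eq_intros)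
  then show ?case
    unfolding funpow.simps o_apply Suc.IH by (rule ext)
qed simp

text \<open>
  With \<open>H v = exp (u * v)\<close> the termwise integration expands \<open>f (u + w)\<close> as a power series in \<open>u\<close>,
  whose coefficients are therefore the Taylor coefficients of \<open>f\<close> at \<open>w\<close>.
\<close>
lemma reproducing_kernel_deriv:
  assumes f: "f \<in> fock_space"
  shows "fock_inner f (\<lambda>z. z ^ n * exp (z * cnj w)) = (deriv ^^ n) f w"
proof -
  have "(\<lambda>n. fock_inner f (\<lambda>z. z ^ n * exp (z * cnj w)) / fact n * u ^ n) sums f (1 * u + w)" for u
  proof -
    have "(\<lambda>n. (deriv ^^ n) (\<lambda>v. exp (u * v)) 0 / fact n * fock_inner f (\<lambda>z. z ^ n * exp (z * cnj w)))
      sums fock_inner f (\<lambda>z. cnj (exp (u * cnj z) * exp (w * cnj z)))"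
    proof (rule fock_inner_power_series_sums[OF f, where d = "1 / 4" and c = "cmod u" and K = 1])
      fix v
      have "Re (u * v) \<le> cmod u * cmod v"
        by (metis complex_Re_le_cmod norm_mult)
      also have "\<dots> \<le> cmod u * cmod v + 1 / 4 * (cmod v)\<^sup>2" by simp
      finally show "cmod (exp (u * v)) \<le> 1 * exp (cmod u * cmod v + 1 / 4 * (cmod v)\<^sup>2)"
        by simp
    qed (auto intro!: holomorphic_intros)
    moreover have "(\<lambda>z. cnj (exp (u * cnj z) * exp (w * cnj z))) = (\<lambda>z. exp (z * cnj (1 * u + w)))"
      by (simp add: exp_cnj algebra_simps flip: exp_add)
    moreover have "(deriv ^^ n) (\<lambda>v. exp (u * v)) 0 = u ^ n" for n
      using higher_deriv_exp_linear[of n 1 u] by simp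
    ultimately show ?thesis
      using reproducing_kernel[OF f, of "1 * u + w"] by (simp only: mult_ac times_divide_eq_right times_divide_eq_left)
  qed
  then have "fock_inner f (\<lambda>z. z ^ n * exp (z * cnj w)) / fact n = (deriv ^^ n) (\<lambda>u. f (1 * u + w)) 0 / fact n"
    by (rule power_series_coeff_unique)
  also have "(deriv ^^ n) (\<lambda>u. f (1 * u + w)) 0 = (deriv ^^ n) f w"
    using higher_deriv_compose_linear'[OF fock_spaceD(1)[OF f], of UNIV 0 1 w n] by simp
  finally show ?thesis by simp
qed

section \<open>Abel summation of the inner product\<close>

text \<open>
  Bounded \<open>L\<^sup>2\<close> norms and pointwise convergence give weak convergence. For \<open>d > 0\<close> the product
  \<open>v * w\<close> is at most \<open>d * w\<^sup>2\<close> where \<open>v < d * w\<close> and at most \<open>v\<^sup>2 / d\<close> elsewhere; the first part has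
  integral at most \<open>d * B\<close>, and the second is covered by dominated convergence.
\<close>
lemma integral_mult_tendsto_0_of_L2_bounded:
  fixes v :: "'a \<Rightarrow> real" and w :: "nat \<Rightarrow> 'a \<Rightarrow> real"
  assumes [measurable]: "v \<in> borel_measurable M" "\<And>n. w n \<in> borel_measurable M"
    and nonneg: "\<And>x. 0 \<le> v x" "\<And>n x. 0 \<le> w n x"
    and v2: "integrable M (\<lambda>x. (v x)\<^sup>2)" and w2: "\<And>n. integrable M (\<lambda>x. (w n x)\<^sup>2)"
    and B: "\<And>n. (LINT x|M. (w n x)\<^sup>2) \<le> B"
    and lim: "\<And>x. (\<lambda>n. w n x) \<longlonglongrightarrow> 0"
  shows "(\<lambda>n. LINT x|M. v x * w n x) \<longlonglongrightarrow> 0"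
proof (rule LIMSEQ_I)
  fix r :: real assume r: "0 < r"
  have B0: "0 \<le> B"
    by (rule order_trans[OF _ B[of 0]]) simp
  define d where "d = r / (2 * (B + 1))"
  have d: "0 < d" "d * B < r / 2"
    using r B0 by (auto simp: d_def field_simps)
  define m where "m n x = min (v x * w n x) ((v x)\<^sup>2 / d)" for n x
  have int_m: "integrable M (m n)" and m_lim: "(\<lambda>n. LINT x|M. m n x) \<longlonglongrightarrow> (LINT x|M. 0)" for n
  proof -
    have dom: "norm (m n x) \<le> (v x)\<^sup>2 / d" for n x
      using nonneg d by (auto simp: m_def)
    have lim_m: "(\<lambda>n. m n x) \<longlonglongrightarrow> 0" for x
    proof -
      have "(\<lambda>n. min (v x * w n x) ((v x)\<^sup>2 / d)) \<longlonglongrightarrow> min (v x * 0) ((v x)\<^sup>2 / d)"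
        by (intro tendsto_intros lim)
      then show ?thesis using d by (simp add: m_def min_def)
    qed
    have meas: "m n \<in> borel_measurable M" for n
      unfolding m_def by measurable
    show "integrable M (m n)" for n
      by (rule integrable_dominated_convergence2[where f = "\<lambda>x. 0" and s = m and w = "\<lambda>x. (v x)\<^sup>2 / d"])
        (use v2 in \<open>auto simp del: real_norm_def intro!: AE_I2 dom lim_m meas\<close>)
    show "(\<lambda>n. LINT x|M. m n x) \<longlonglongrightarrow> (LINT x|M. 0)"
      by (rule integral_dominated_convergence[where w = "\<lambda>x. (v x)\<^sup>2 / d"])
        (use v2 in \<open>auto simp del: real_norm_def intro!: AE_I2 dom lim_m meas\<close>)
  qed
  have le: "v x * w n x \<le> d * (w n x)\<^sup>2 + m n x" for n x
  proof (cases "d * w n x \<le> v x")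
    case True
    then have "v x * (d * w n x) \<le> v x * v x"
      using nonneg by (intro mult_left_mono) auto
    then have "v x * w n x \<le> (v x)\<^sup>2 / d"
      using d by (simp add: field_simps power2_eq_square)
    then show ?thesis using d by (simp add: m_def)
  next
    case False
    then have "v x * w n x \<le> (d * w n x) * w n x"
      using nonneg by (intro mult_right_mono) auto
    moreover have "0 \<le> m n x"
      using nonneg d by (simp add: m_def)
    ultimately show ?thesis by (simp add: power2_eq_square mult.assoc)
  qed
  obtain N where N: "\<And>n. n \<ge> N \<Longrightarrow> (LINT x|M. m n x) < r / 2"
    using order_tendstoD(2)[OF m_lim, of "r / 2"] r by (auto simp: eventually_sequentially)
  have "norm ((LINT x|M. v x * w n x) - 0) < r" if "n \<ge> N" for n
  proof -
    have int: "integrable M (\<lambda>x. d * (w n x)\<^sup>2 + m n x)"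
      using w2 int_m by auto
    have "(LINT x|M. v x * w n x) \<le> (LINT x|M. d * (w n x)\<^sup>2 + m n x)"
    proof (rule integral_mono[OF _ int])
      show "integrable M (\<lambda>x. v x * w n x)"
        by (rule Bochner_Integration.integrable_bound[OF int])
          (use nonneg le in \<open>auto intro!: AE_I2 intro: order_trans[OF _ abs_ge_self]\<close>)
    qed (rule le)
    also have "\<dots> = d * (LINT x|M. (w n x)\<^sup>2) + (LINT x|M. m n x)"
      using w2 int_m by simp
    also have "\<dots> < r / 2 + r / 2"
      using d B[of n] mult_left_mono[OF B[of n], of d] N[OF that] by linarith
    finally have "(LINT x|M. v x * w n x) < r" by simp
    moreover have "0 \<le> (LINT x|M. v x * w n x)"
      by (intro Bochner_Integration.integral_nonneg mult_nonneg_nonneg nonneg)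
    ultimately show ?thesis by simp
  qed
  then show "\<exists>N. \<forall>n\<ge>N. norm ((LINT x|M. v x * w n x) - 0) < r"
    by blast
qed

lemma fock_inner_tendsto_of_norm_bounded:
  assumes f: "f \<in> fock_space" and q: "q \<in> fock_space" and p: "\<And>n. p n \<in> fock_space"
    and B: "\<And>n. (LINT z|lborel. (cmod (p n z))\<^sup>2 * exp (- (cmod z)\<^sup>2)) \<le> B"
    and lim: "\<And>z. (\<lambda>n. p n z) \<longlonglongrightarrow> q z"
  shows "(\<lambda>n. fock_inner f (p n)) \<longlonglongrightarrow> fock_inner f q"
proof -
  define v where "v z = cmod (f z) * exp (- (cmod z)\<^sup>2 / 2)" for z
  define w where "w n z = cmod (p n z - q z) * exp (- (cmod z)\<^sup>2 / 2)" for n z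
  note [measurable] = fock_spaceD(2)[OF f] fock_spaceD(2)[OF q] fock_spaceD(2)[OF p]
  let ?E = "\<lambda>z. exp (- (cmod z)\<^sup>2)"
  have half: "(exp (- (cmod z)\<^sup>2 / 2))\<^sup>2 = exp (- (cmod z)\<^sup>2)" for z
    by (simp add: power2_eq_square flip: exp_add)
  have v2: "(v z)\<^sup>2 = (cmod (f z))\<^sup>2 * ?E z" and w2: "(w n z)\<^sup>2 = (cmod (p n z - q z))\<^sup>2 * ?E z" for n z
    by (simp_all only: v_def w_def power_mult_distrib half)
  have int: "integrable lborel (\<lambda>z. 2 * ((cmod (p n z))\<^sup>2 * ?E z) + 2 * ((cmod (q z))\<^sup>2 * ?E z))" for n
    using fock_spaceD(3)[OF p] fock_spaceD(3)[OF q] by simp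
  have w2_le: "(w n z)\<^sup>2 \<le> 2 * ((cmod (p n z))\<^sup>2 * ?E z) + 2 * ((cmod (q z))\<^sup>2 * ?E z)" for n z
  proof -
    have "(cmod (p n z - q z))\<^sup>2 \<le> (cmod (p n z) + cmod (q z))\<^sup>2"
      by (intro power_mono norm_triangle_ineq4) auto
    also have "\<dots> \<le> 2 * (cmod (p n z))\<^sup>2 + 2 * (cmod (q z))\<^sup>2"
      using sum_squares_bound[of "cmod (p n z)" "cmod (q z)"] by (simp add: power2_sum)
    finally have "(cmod (p n z - q z))\<^sup>2 * ?E z \<le> (2 * (cmod (p n z))\<^sup>2 + 2 * (cmod (q z))\<^sup>2) * ?E z"
      by (rule mult_right_mono) simp
    then show ?thesis by (simp add: w2 algebra_simps)
  qed
  have w_meas: "w n \<in> borel_measurable lborel" for n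
    unfolding w_def by measurable
  have int_w2: "integrable lborel (\<lambda>z. (w n z)\<^sup>2)" for n
    by (rule Bochner_Integration.integrable_bound[OF int[of n]])
      (use w2_le w_meas in \<open>auto intro: order_trans[OF _ abs_ge_self]\<close>)
  have "(\<lambda>n. LINT z|lborel. v z * w n z) \<longlonglongrightarrow> 0"
  proof (rule integral_mult_tendsto_0_of_L2_bounded)
    show "v \<in> borel_measurable lborel"
      unfolding v_def by measurable
    show "integrable lborel (\<lambda>z. (v z)\<^sup>2)"
      unfolding v2 using fock_spaceD(3)[OF f] .
    show "(LINT z|lborel. (w n z)\<^sup>2) \<le> 2 * B + 2 * (LINT z|lborel. (cmod (q z))\<^sup>2 * ?E z)" for n
    proof -
      have "(LINT z|lborel. (w n z)\<^sup>2) \<le> (LINT z|lborel. 2 * ((cmod (p n z))\<^sup>2 * ?E z) + 2 * ((cmod (q z))\<^sup>2 * ?E z))"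
        by (rule integral_mono[OF int_w2 int w2_le])
      also have "\<dots> = 2 * (LINT z|lborel. (cmod (p n z))\<^sup>2 * ?E z) + 2 * (LINT z|lborel. (cmod (q z))\<^sup>2 * ?E z)"
        using fock_spaceD(3)[OF p] fock_spaceD(3)[OF q] by simp
      finally show ?thesis using B[of n] by simp
    qed
    show "(\<lambda>n. w n z) \<longlonglongrightarrow> 0" for z
    proof -
      have "(\<lambda>n. cmod (p n z - q z) * exp (- (cmod z)\<^sup>2 / 2)) \<longlonglongrightarrow> cmod (q z - q z) * exp (- (cmod z)\<^sup>2 / 2)"
        by (intro tendsto_intros lim)
      then show ?thesis by (simp add: w_def)
    qed
    show "w n \<in> borel_measurable lborel" "integrable lborel (\<lambda>z. (w n z)\<^sup>2)" for n
      by (rule w_meas int_w2)+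
  qed (auto simp: v_def w_def)
  then have lim0: "(\<lambda>n. 1 / pi * (LINT z|lborel. v z * w n z)) \<longlonglongrightarrow> 0"
    by (auto intro: tendsto_mult_right_zero)
  have vw: "norm (f z * cnj (p n z) * of_real (?E z) - f z * cnj (q z) * of_real (?E z)) = v z * w n z" for n z
  proof -
    have "f z * cnj (p n z) * of_real (?E z) - f z * cnj (q z) * of_real (?E z)
        = f z * cnj (p n z - q z) * of_real (?E z)"
      by (simp add: algebra_simps)
    then have "norm (f z * cnj (p n z) * of_real (?E z) - f z * cnj (q z) * of_real (?E z))
        = cmod (f z) * cmod (p n z - q z) * ?E z"
      by (simp only: norm_mult complex_mod_cnj norm_of_real abs_exp_cancel)
    also have "\<dots> = v z * w n z"
      unfolding v_def w_def using half[of z, unfolded power2_eq_square[of "exp _"]] by (simp only: mult_ac)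
    finally show ?thesis .
  qed
  have "cmod (fock_inner f (p n) - fock_inner f q) \<le> 1 / pi * (LINT z|lborel. v z * w n z)" for n
  proof -
    let ?D = "\<lambda>z. f z * cnj (p n z) * of_real (?E z) - f z * cnj (q z) * of_real (?E z)"
    have diff: "fock_inner f (p n) - fock_inner f q = 1 / of_real pi * (LINT z|lborel. ?D z)"
      unfolding fock_inner_def right_diff_distrib[symmetric]
      by (subst Bochner_Integration.integral_diff) (auto intro: integrable_fock_inner f p q)
    have "cmod (LINT z|lborel. ?D z) \<le> (LINT z|lborel. norm (?D z))"
      by (rule integral_norm_bound)
    then have "cmod (LINT z|lborel. ?D z) \<le> (LINT z|lborel. v z * w n z)"
      by (simp only: vw)
    then show ?thesis
      unfolding diff norm_mult by (simp add: norm_divide divide_right_mono)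
  qed
  then have "(\<lambda>n. fock_inner f (p n) - fock_inner f q) \<longlonglongrightarrow> 0"
    by (intro Lim_null_comparison[OF _ lim0]) auto
  then show ?thesis
    by (simp add: LIM_zero_iff)
qed

text \<open>
  For \<open>t < 1\<close> the Abel sum is the inner product of \<open>f\<close> with the function \<open>P t\<close> obtained by replacing
  \<open>H u\<close> with \<open>H (t * u)\<close>: this lowers the growth of \<open>H\<close> to \<open>t\<^sup>2 / 2 < 1 / 2\<close> and makes termwise
  integration legitimate. As \<open>t\<close> tends to 1, \<open>P t\<close> converges pointwise to \<open>p\<close> with bounded norms,
  hence weakly. For \<open>s = 0\<close> the theorem is Parseval's identity.
\<close>
theorem fock_inner_Abel_summation:
  assumes f: "f \<in> fock_space" and p: "p \<in> fock_space" and H: "H holomorphic_on UNIV"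
    and pH: "\<And>z. p z = cnj (H (cnj z) * exp (s * cnj z))"
  shows "((\<lambda>t::real. \<Sum>n. of_real t ^ n * ((deriv ^^ n) H 0 / fact n * (deriv ^^ n) f s))
    \<longlongrightarrow> fock_inner f p) (at_left 1)"
proof -
  define P where "P t z = p (of_real t * z) * exp (of_real (1 - t) * cnj s * z)" for t :: real and z
  obtain K where K: "\<And>z. cmod (p z) \<le> K * exp ((cmod z)\<^sup>2 / 2)"
    using fock_pointwise_bound[OF p] by blast
  have K0: "0 \<le> K"
    using order_trans[OF norm_ge_zero K[of 0]] by simp
  have P_fock: "P t \<in> fock_space" if t: "0 < t" "t < 1" for t
  proof (rule fock_spaceI_growth)
    show "P t holomorphic_on UNIV"
      unfolding P_def using entire_compose_affine[OF fock_spaceD(1)[OF p], of "of_real t" 0]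
      by (intro holomorphic_intros) simp_all
    show "t\<^sup>2 / 2 < 1 / 2"
      using t by (simp add: power_less_one_iff)
    fix z
    have "Re (of_real (1 - t) * cnj s * z) \<le> cmod (of_real (1 - t) * cnj s * z)"
      by (rule complex_Re_le_cmod)
    also have "\<dots> = ((1 - t) * cmod s) * cmod z"
      using t by (simp add: norm_mult del: of_real_diff)
    finally have "cmod (P t z) \<le> (K * exp ((cmod (of_real t * z))\<^sup>2 / 2)) * exp (((1 - t) * cmod s) * cmod z)"
      unfolding P_def norm_mult[of "p _"] norm_exp_eq_Re using K0 by (intro mult_mono K) auto
    also have "\<dots> = K * exp (((1 - t) * cmod s) * cmod z + t\<^sup>2 / 2 * (cmod z)\<^sup>2)"
      unfolding mult.assoc exp_add[symmetric] by (simp add: norm_mult power_mult_distrib algebra_simps)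
    finally show "cmod (P t z) \<le> K * exp (((1 - t) * cmod s) * cmod z + t\<^sup>2 / 2 * (cmod z)\<^sup>2)" .
  qed
  \<comment> \<open>after completing the square, the norm of \<open>P t\<close> is controlled by that of the dilate of \<open>p\<close>\<close>
  have P_norm: "(LINT z|lborel. (cmod (P t z))\<^sup>2 * exp (- (cmod z)\<^sup>2))
      \<le> 4 * exp ((cmod s)\<^sup>2) * (LINT z|lborel. (cmod (p z))\<^sup>2 * exp (- (cmod z)\<^sup>2))" if t: "1 / 2 < t" "t < 1" for t
  proof -
    let ?G = "\<lambda>z. (cmod (p z))\<^sup>2 * exp (- (cmod z)\<^sup>2)"
    have le: "(cmod (P t z))\<^sup>2 * exp (- (cmod z)\<^sup>2) \<le> exp ((cmod s)\<^sup>2) * ?G (of_real t * z)" for z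
    proof -
      have "2 * Re (of_real (1 - t) * cnj s * z) \<le> 2 * cmod (of_real (1 - t) * cnj s * z)"
        by (intro mult_left_mono complex_Re_le_cmod) simp
      also have "\<dots> = (1 - t) * (2 * cmod s * cmod z)"
        using t by (simp add: norm_mult del: of_real_diff)
      also have "\<dots> \<le> (1 - t) * ((cmod s)\<^sup>2 + (cmod z)\<^sup>2)"
        using t by (intro mult_left_mono sum_squares_bound) auto
      also have "\<dots> \<le> (cmod s)\<^sup>2 + (1 - t\<^sup>2) * (cmod z)\<^sup>2"
      proof -
        have "(1 - t) * (cmod s)\<^sup>2 \<le> 1 * (cmod s)\<^sup>2"
          using t by (intro mult_right_mono) auto
        moreover have "(1 - t) * (cmod z)\<^sup>2 \<le> (1 - t\<^sup>2) * (cmod z)\<^sup>2"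
          using t by (intro mult_right_mono) (auto simp: power2_eq_square)
        ultimately show ?thesis by (simp add: distrib_left)
      qed
      finally have "exp (2 * Re (of_real (1 - t) * cnj s * z)) * exp (- (cmod z)\<^sup>2) \<le> exp ((cmod s)\<^sup>2) * exp (- (cmod (of_real t * z))\<^sup>2)"
        unfolding exp_add[symmetric] by (simp add: norm_mult power_mult_distrib algebra_simps)
      then have "(cmod (p (of_real t * z)))\<^sup>2 * (exp (2 * Re (of_real (1 - t) * cnj s * z)) * exp (- (cmod z)\<^sup>2))
          \<le> (cmod (p (of_real t * z)))\<^sup>2 * (exp ((cmod s)\<^sup>2) * exp (- (cmod (of_real t * z))\<^sup>2))"
        by (rule mult_left_mono) simp
      then show ?thesis
        unfolding P_def norm_mult norm_exp_eq_Re power_mult_distrib exp_double[symmetric] by (simp only: mult_ac)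
    qed
    have "(LINT z|lborel. (cmod (P t z))\<^sup>2 * exp (- (cmod z)\<^sup>2)) \<le> (LINT z|lborel. exp ((cmod s)\<^sup>2) * ?G (of_real t * z))"
      using t fock_spaceD(3)[OF P_fock[of t]] integrable_dilation[of t ?G, OF _ fock_spaceD(3)[OF p]]
      by (intro integral_mono le) auto
    also have "\<dots> = exp ((cmod s)\<^sup>2) * (LINT z|lborel. ?G (of_real t * z))"
      by simp
    also have "\<dots> \<le> exp ((cmod s)\<^sup>2) * (4 * (LINT z|lborel. ?G z))"
    proof (rule mult_left_mono)
      let ?I = "LINT z|lborel. ?G (of_real t * z)"
      have "1 / 4 \<le> t\<^sup>2"
        using t power_mono[of "1 / 2" t 2] by (simp add: power2_eq_square)
      moreover have "0 \<le> ?I" by simp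
      ultimately have "1 / 4 * ?I \<le> t\<^sup>2 * ?I"
        by (rule mult_right_mono)
      also have "\<dots> = (LINT z|lborel. ?G z)"
        using t integral_dilation[of t ?G, OF _ fock_spaceD(3)[OF p]] by simp
      finally show "?I \<le> 4 * (LINT z|lborel. ?G z)" by simp
    qed simp
    finally show ?thesis by simp
  qed
  have P_series: "fock_inner f (P t) = (\<Sum>n. of_real t ^ n * ((deriv ^^ n) H 0 / fact n * (deriv ^^ n) f s))"
    if t: "0 < t" "t < 1" for t
  proof -
    define Ht where "Ht u = H (of_real t * u)" for u
    have Ht: "Ht holomorphic_on UNIV"
      using entire_compose_affine[OF H, of "of_real t" 0] by (simp add: Ht_def[abs_def])
    have bound: "cmod (Ht u) \<le> K * exp ((t * cmod s) * cmod u + t\<^sup>2 / 2 * (cmod u)\<^sup>2)" for u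
    proof -
      let ?v = "of_real t * u"
      have "H ?v = cnj (p (cnj ?v)) * exp (- (s * ?v))"
        unfolding pH by (simp add: mult.assoc flip: exp_add)
      then have "cmod (Ht u) = cmod (p (cnj ?v)) * exp (- Re (s * ?v))"
        unfolding Ht_def by (simp add: norm_mult)
      also have "\<dots> \<le> (K * exp ((cmod (cnj ?v))\<^sup>2 / 2)) * exp (cmod (s * ?v))"
        using K0 abs_Re_le_cmod[of "s * ?v"] by (intro mult_mono K) auto
      also have "\<dots> = K * exp ((t * cmod s) * cmod u + t\<^sup>2 / 2 * (cmod u)\<^sup>2)"
        unfolding mult.assoc exp_add[symmetric] using t
        by (simp add: norm_mult power_mult_distrib algebra_simps)
      finally show ?thesis .
    qed
    have "t\<^sup>2 / 2 < 1 / 2"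
      using t by (simp add: power_less_one_iff)
    then have "(\<lambda>n. (deriv ^^ n) Ht 0 / fact n * fock_inner f (\<lambda>z. z ^ n * exp (z * cnj s)))
        sums fock_inner f (\<lambda>z. cnj (Ht (cnj z) * exp (s * cnj z)))"
      using t K0 by (intro fock_inner_power_series_sums[OF f Ht _ _ _ _ bound]) auto
    moreover have "(deriv ^^ n) Ht 0 = of_real t ^ n * (deriv ^^ n) H 0" for n
      using higher_deriv_compose_linear[OF H, of UNIV 0 "of_real t" n] by (simp add: Ht_def[abs_def])
    moreover have "(\<lambda>z. cnj (Ht (cnj z) * exp (s * cnj z))) = P t"
    proof
      fix z
      have "P t z = cnj (H (of_real t * cnj z)) * (exp (cnj s * of_real t * z) * exp (of_real (1 - t) * cnj s * z))"
        unfolding P_def pH by (simp add: exp_cnj mult_ac)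
      also have "exp (cnj s * of_real t * z) * exp (of_real (1 - t) * cnj s * z) = exp (cnj s * z)"
        unfolding exp_add[symmetric] by (simp add: algebra_simps)
      finally show "cnj (Ht (cnj z) * exp (s * cnj z)) = P t z"
        by (simp add: Ht_def exp_cnj)
    qed
    ultimately have "(\<lambda>n. of_real t ^ n * ((deriv ^^ n) H 0 / fact n * (deriv ^^ n) f s)) sums fock_inner f (P t)"
      by (simp add: reproducing_kernel_deriv[OF f] mult.assoc)
    then show ?thesis by (rule sums_unique)
  qed
  have "((\<lambda>t. fock_inner f (P t)) \<longlongrightarrow> fock_inner f p) (at_left 1)"
  proof (rule tendsto_at_left_sequentially[of "1 / 2"])
    fix S :: "nat \<Rightarrow> real"
    assume S: "\<And>n. S n < 1" "\<And>n. 1 / 2 < S n" "S \<longlonglongrightarrow> 1"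
    have S0: "0 < S n" for n using S(2)[of n] by simp
    show "(\<lambda>n. fock_inner f (P (S n))) \<longlonglongrightarrow> fock_inner f p"
    proof (rule fock_inner_tendsto_of_norm_bounded[OF f p P_fock[OF S0 S(1)] P_norm[OF S(2) S(1)]])
      fix z
      have "isCont p w" for w
        using entire_continuous_on[OF fock_spaceD(1)[OF p], of UNIV] by (simp add: continuous_on_eq_continuous_at)
      then have "(\<lambda>n. P (S n) z) \<longlonglongrightarrow> p (of_real 1 * z) * exp (of_real (1 - 1) * cnj s * z)"
        unfolding P_def by (intro tendsto_intros isCont_tendsto_compose[of _ p] S(3))
      then show "(\<lambda>n. P (S n) z) \<longlonglongrightarrow> p z" by simp
    qed
  qed simp
  moreover have "\<forall>\<^sub>F t in at_left 1. fock_inner f (P t) = (\<Sum>n. of_real t ^ n * ((deriv ^^ n) H 0 / fact n * (deriv ^^ n) f s))"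
    using eventually_at_left_real[OF zero_less_one] by eventually_elim (rule P_series; simp)
  ultimately show ?thesis
    by (rule Lim_transform_eventually)
qed

section \<open>The weighted composition conjugation\<close>

definition fock_kernel :: "nat \<Rightarrow> complex \<Rightarrow> complex \<Rightarrow> complex" where
  "fock_kernel n w = (\<lambda>z. z ^ n * exp (z * cnj w))"

lemma fock_space_kernel: "fock_kernel n w \<in> fock_space"
  unfolding fock_kernel_def by (rule fock_space_power_exp)

locale conjugation_parameters =
  fixes a b c :: complex
  assumes norm_a: "cmod a = 1"
    and ab: "cnj a * b + cnj b = 0"
    and norm_c: "(cmod c)\<^sup>2 * exp ((cmod b)\<^sup>2) = 1"
begin

abbreviation C :: "(complex \<Rightarrow> complex) \<Rightarrow> complex \<Rightarrow> complex" where
  "C \<equiv> wc_conjugation a b c"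

text \<open>
  The conjugation substitutes this measure preserving involution of the plane.
\<close>
definition reflection :: "complex \<Rightarrow> complex" where
  "reflection z = cnj (a * z + b)"

lemma cnj_a: "cnj a * a = 1" "a * cnj a = 1"
  using norm_a by (simp_all add: complex_norm_square[symmetric] mult.commute[of "cnj a"])

lemma a_nonzero: "a \<noteq> 0"
  using norm_a by auto

lemma a_cnj_b: "a * cnj b = - b" "cnj a * b = - cnj b"
proof -
  show "cnj a * b = - cnj b"
    using ab by (simp add: eq_neg_iff_add_eq_0)
  then show "a * cnj b = - b"
    by (metis complex_cnj_cnj complex_cnj_minus complex_cnj_mult)
qed

lemma reflection_reflection: "reflection (reflection z) = z"
proof -
  have "reflection (reflection z) = (cnj a * a) * z + (cnj a * b + cnj b)"
    by (simp add: reflection_def algebra_simps)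
  then show ?thesis by (simp only: cnj_a ab) simp
qed

lemma continuous_reflection: "continuous_on A reflection"
  unfolding reflection_def by (intro continuous_intros)

lemma borel_measurable_reflection: "reflection \<in> borel_measurable borel"
  by (intro borel_measurable_continuous_onI continuous_reflection)

lemma distr_reflection: "distr lborel borel reflection = lborel"
proof -
  have "distr lborel borel reflection = distr (distr (distr lborel borel (\<lambda>z. a * z)) borel (\<lambda>z. b + z)) borel cnj"
  proof -
    have "(*) a \<in> borel_measurable borel" "(+) b \<in> borel_measurable borel" "cnj \<in> borel_measurable borel"
      by (intro borel_measurable_continuous_onI continuous_intros)+
    then show ?thesis
      by (simp add: distr_distr reflection_def[abs_def] comp_def add.commute)
  qed
  then show ?thesis
    by (simp only: distr_lborel_rotation[OF norm_a] lborel_distr_plus distr_lborel_cnj)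
qed

lemma norm_reflection: "(cmod (reflection z))\<^sup>2 = (cmod z)\<^sup>2 - 2 * Re (b * z) + (cmod b)\<^sup>2"
proof -
  have "complex_of_real ((cmod (reflection z))\<^sup>2) = (a * z + b) * (cnj a * cnj z + cnj b)"
    unfolding complex_norm_square reflection_def by (simp add: mult.commute)
  also have "\<dots> = (a * cnj a) * (z * cnj z) + (a * cnj b) * z + (cnj a * b) * cnj z + b * cnj b"
    by (simp add: algebra_simps)
  also have "\<dots> = z * cnj z - (b * z + cnj (b * z)) + b * cnj b"
    by (simp only: cnj_a a_cnj_b) simp
  also have "\<dots> = complex_of_real ((cmod z)\<^sup>2 - 2 * Re (b * z) + (cmod b)\<^sup>2)"
    by (simp only: complex_add_cnj of_real_add of_real_diff complex_norm_square)
  finally show ?thesis by (simp only: of_real_eq_iff)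
qed

text \<open>
  The normalisation of \<open>c\<close> compensates the constant \<open>exp (\<bar>b\<bar>\<^sup>2)\<close> from completing the square, so the
  weighted modulus is merely transported by the reflection and \<open>C\<close> is isometric.
\<close>
lemma norm_C: "(cmod (C f z))\<^sup>2 * exp (- (cmod z)\<^sup>2) = (cmod (f (reflection z)))\<^sup>2 * exp (- (cmod (reflection z))\<^sup>2)"
proof -
  have "(cmod (C f z))\<^sup>2 * exp (- (cmod z)\<^sup>2)
      = (cmod (f (reflection z)))\<^sup>2 * ((cmod c)\<^sup>2 * (exp (2 * Re (b * z)) * exp (- (cmod z)\<^sup>2)))"
    unfolding wc_conjugation_def norm_mult reflection_def complex_mod_cnj norm_exp_eq_Re power_mult_distrib exp_double
    by (simp only: mult_ac)
  also have "exp (2 * Re (b * z)) * exp (- (cmod z)\<^sup>2) = exp ((cmod b)\<^sup>2) * exp (- (cmod (reflection z))\<^sup>2)"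
    unfolding exp_add[symmetric] norm_reflection by (simp add: algebra_simps)
  finally show ?thesis
    unfolding mult.assoc[symmetric, of "(cmod c)\<^sup>2"] norm_c by simp
qed

lemma C_holomorphic:
  assumes "f holomorphic_on UNIV"
  shows "C f holomorphic_on UNIV"
proof -
  have "(\<lambda>z. cnj (f (cnj z))) holomorphic_on UNIV"
    using holomorphic_on_compose_cnj_cnj[of f UNIV] assms surjI[of cnj cnj] by (simp add: o_def)
  from entire_compose_affine[OF this, of a b] show ?thesis
    unfolding wc_conjugation_def by (intro holomorphic_intros)
qed

lemma C_fock:
  assumes f: "f \<in> fock_space"
  shows "C f \<in> fock_space"
proof -
  have [measurable]: "f \<in> borel_measurable borel"
    by (rule fock_spaceD[OF f])
  have "integrable lborel (\<lambda>z. (cmod (f (reflection z)))\<^sup>2 * exp (- (cmod (reflection z))\<^sup>2))"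
    using fock_spaceD(3)[OF f]
    by (subst integrable_measure_preserving[OF distr_reflection borel_measurable_reflection, where G = "\<lambda>z. (cmod (f z))\<^sup>2 * exp (- (cmod z)\<^sup>2)"]) measurable
  then show ?thesis
    using C_holomorphic[OF fock_spaceD(1)[OF f]] by (simp add: fock_space_def norm_C)
qed

lemma C_C: "C (C f) = f"
proof
  fix z
  have TT: "cnj (a * cnj (a * z + b) + b) = z"
    using reflection_reflection[of z] by (simp add: reflection_def)
  have "C (C f) z = (c * cnj c) * exp (b * z + cnj b * (a * z + b)) * f z"
    unfolding wc_conjugation_def TT by (simp add: exp_cnj exp_add mult_ac)
  also have "b * z + cnj b * (a * z + b) = (b + a * cnj b) * z + b * cnj b"
    by (simp add: algebra_simps)
  also have "\<dots> = b * cnj b"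
    by (simp add: a_cnj_b)
  also have "(c * cnj c) * exp (b * cnj b) = complex_of_real ((cmod c)\<^sup>2 * exp ((cmod b)\<^sup>2))"
    by (simp only: of_real_mult exp_of_real[symmetric] complex_norm_square)
  finally show "C (C f) z = f z"
    by (simp only: norm_c) simp
qed

text \<open>
  The bilinear form \<open>(f, g) \<mapsto> fock_inner f (C g)\<close> is symmetric: substituting the reflection exchanges
  the arguments of \<open>f\<close> and \<open>g\<close> and leaves the weight \<open>cnj (exp (b * z)) * exp (- \<bar>z\<bar>\<^sup>2)\<close> unchanged.
\<close>
lemma fock_inner_C_sym:
  assumes f: "f \<in> fock_space" and g: "g \<in> fock_space"
  shows "fock_inner f (C g) = fock_inner g (C f)"
proof -
  define F where "F z = f z * cnj (C g z) * of_real (exp (- (cmod z)\<^sup>2))" for z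
  have F: "F \<in> borel_measurable borel"
    using integrable_fock_inner[OF f C_fock[OF g]] unfolding F_def by auto
  have "F (reflection z) = g z * cnj (C f z) * of_real (exp (- (cmod z)\<^sup>2))" for z
  proof -
    have "cnj (exp (b * reflection z)) * of_real (exp (- (cmod (reflection z))\<^sup>2)) = exp (cnj b * (a * z + b) - reflection z * cnj (reflection z))"
      unfolding of_real_gaussian exp_cnj exp_add[symmetric] by (rule arg_cong[where f = exp]) (simp add: reflection_def)
    also have "cnj b * (a * z + b) - reflection z * cnj (reflection z)
        = (cnj b - cnj b) * (a * z + b) - (cnj a * a) * (cnj z * z) - (cnj a * b) * cnj z"
      by (simp add: reflection_def algebra_simps)
    also have "\<dots> = cnj (b * z) - z * cnj z"
      by (simp only: cnj_a a_cnj_b) simp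
    also have "exp \<dots> = cnj (exp (b * z)) * of_real (exp (- (cmod z)\<^sup>2))"
      unfolding of_real_gaussian exp_cnj exp_add[symmetric] by simp
    finally have "cnj (exp (b * reflection z)) * of_real (exp (- (cmod (reflection z))\<^sup>2)) = cnj (exp (b * z)) * of_real (exp (- (cmod z)\<^sup>2))" .
    then have "f (reflection z) * cnj c * g z * (cnj (exp (b * reflection z)) * of_real (exp (- (cmod (reflection z))\<^sup>2)))
        = f (reflection z) * cnj c * g z * (cnj (exp (b * z)) * of_real (exp (- (cmod z)\<^sup>2)))"
      by simp
    moreover have "cnj (C g (reflection z)) = cnj c * cnj (exp (b * reflection z)) * g z"
      unfolding wc_conjugation_def reflection_def[symmetric] reflection_reflection by simp
    moreover have "cnj (C f z) = cnj c * cnj (exp (b * z)) * f (reflection z)"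
      unfolding wc_conjugation_def reflection_def[symmetric] by simp
    ultimately show ?thesis
      unfolding F_def by (simp only: mult_ac)
  qed
  then have "(LINT z|lborel. F z) = (LINT z|lborel. g z * cnj (C f z) * of_real (exp (- (cmod z)\<^sup>2)))"
    using integral_measure_preserving[OF distr_reflection borel_measurable_reflection F] by simp
  then show ?thesis
    by (simp add: fock_inner_def F_def)
qed

lemma fock_inner_C_C:
  assumes "f \<in> fock_space" "g \<in> fock_space"
  shows "fock_inner (C f) (C g) = fock_inner g f"
  using fock_inner_C_sym[OF C_fock[OF assms(1)] assms(2)] by (simp add: C_C)

lemma C_kernel: "C (fock_kernel n w) z = c * exp (b * z) * (a * z + b) ^ n * exp ((a * z + b) * w)"
  by (simp add: wc_conjugation_def fock_kernel_def exp_cnj)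

lemma fock_inner_C_kernel:
  assumes "f \<in> fock_space"
  shows "fock_inner (C (fock_kernel n w)) (C f) = (deriv ^^ n) f w"
  using fock_inner_C_C[OF fock_space_kernel assms] reproducing_kernel_deriv[OF assms]
  by (simp add: fock_kernel_def)

lemma c_nonzero: "c \<noteq> 0"
  using norm_c by auto

end

section \<open>The functional equation of the kernel pairs\<close>

lemma entire_eq_if_eq_on_open:
  assumes f: "f holomorphic_on UNIV" and U: "open U" "w \<in> U" and 0: "\<And>z. z \<in> U \<Longrightarrow> f z = 0"
  shows "f z = (0 :: complex)"
  using analytic_continuation_open[of U UNIV f "\<lambda>_. 0" z] assms by auto

lemma entire_common_nonzero:
  assumes f: "f holomorphic_on UNIV" "f x \<noteq> (0 :: complex)" and g: "g holomorphic_on UNIV" "g y \<noteq> (0 :: complex)"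
  obtains z where "f z \<noteq> 0" "g z \<noteq> 0"
proof -
  have "open (f -` (- {0}))"
    by (intro open_vimage entire_continuous_on f) auto
  then have "\<exists>z. f z \<noteq> 0 \<and> g z \<noteq> 0"
    using entire_eq_if_eq_on_open[OF g(1), of "f -` (- {0})" x y] f(2) g(2) by auto
  then show ?thesis using that by blast
qed

text \<open>
  At a point \<open>z0\<close> where \<open>h\<close> and \<open>q\<close> do not vanish the equation gives \<open>h y = k * q y * exp (E y)\<close> with
  \<open>E\<close> explicit in \<open>\<phi>\<close>. At a second point \<open>z1\<close> it then says \<open>q * (exp \<Theta> - 1) = 0\<close>, where \<open>\<Theta>\<close> is \<open>a\<close>
  times the determinant expressing collinearity of the points of the graph of \<open>\<phi>\<close> over \<open>y\<close>, \<open>z0\<close>,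
  \<open>z1\<close>. So \<open>\<Theta>\<close> is constant, and it vanishes at \<open>z1\<close>: the graph is a line.
\<close>
lemma kernel_equation_solution:
  fixes h \<phi> :: "complex \<Rightarrow> complex" and a b :: complex and m :: nat
  defines "q \<equiv> \<lambda>z. (a * \<phi> z + b) ^ m"
  assumes a: "a \<noteq> 0" and \<phi>: "\<phi> holomorphic_on UNIV" and h: "h holomorphic_on UNIV" "h x \<noteq> 0" and q: "q x' \<noteq> 0"
    and eq: "\<And>y z. h y * q z * exp (b * \<phi> z + (a * \<phi> z + b) * y) = h z * q y * exp (b * z + (a * z + b) * \<phi> y)"
  obtains A B C where "\<And>y. \<phi> y = A * y + B" "\<And>y. C * exp ((b + a * B - b * A) * y) * h y = q y"
proof -
  have hol_q: "q holomorphic_on UNIV"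
    unfolding q_def by (intro holomorphic_intros \<phi>)
  obtain z0 where z0: "h z0 \<noteq> 0" "q z0 \<noteq> 0"
    using entire_common_nonzero[OF h hol_q q] by blast
  have "(\<lambda>z. z - z0) holomorphic_on UNIV"
    by (intro holomorphic_intros)
  then obtain z1 where z1: "z1 - z0 \<noteq> 0" "q z1 \<noteq> 0"
    using entire_common_nonzero[of "\<lambda>z. z - z0" "z0 + 1" q x'] hol_q q by auto
  define k where "k = h z0 / q z0"
  define E where "E y = b * z0 + (a * z0 + b) * \<phi> y - (b * \<phi> z0 + (a * \<phi> z0 + b) * y)" for y
  have k: "k \<noteq> 0" using z0 by (simp add: k_def)
  have h_eq: "h y = k * q y * exp (E y)" for y
    using eq[of y z0] z0(2) by (simp add: k_def E_def exp_diff field_simps)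
  define \<Theta> where "\<Theta> y = a * ((z0 - z1) * \<phi> y + (\<phi> z1 - \<phi> z0) * y + (\<phi> z0 * z1 - \<phi> z1 * z0))" for y
  have \<Theta>_hol: "\<Theta> holomorphic_on UNIV"
    unfolding \<Theta>_def by (intro holomorphic_intros \<phi>)
  have prod: "q y * (exp (\<Theta> y) - 1) = 0" for y
  proof -
    have "k * q z1 * (q y * exp (E y + (b * \<phi> z1 + (a * \<phi> z1 + b) * y)))
        = k * q z1 * (q y * exp (E z1 + (b * z1 + (a * z1 + b) * \<phi> y)))"
      using eq[of y z1] unfolding h_eq exp_add[of "E _"] by (simp only: mult_ac)
    then have "q y * exp (E y + (b * \<phi> z1 + (a * \<phi> z1 + b) * y)) = q y * exp (E z1 + (b * z1 + (a * z1 + b) * \<phi> y))"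
      using k z1 by simp
    moreover define W where "W = E z1 + (b * z1 + (a * z1 + b) * \<phi> y)"
    moreover have "E y + (b * \<phi> z1 + (a * \<phi> z1 + b) * y) = \<Theta> y + (E z1 + (b * z1 + (a * z1 + b) * \<phi> y))"
      by (simp add: E_def \<Theta>_def algebra_simps)
    ultimately have "q y * exp (\<Theta> y + W) = q y * exp W"
      by (simp only: )
    then have "q y * (exp (\<Theta> y) - 1) * exp W = 0"
      unfolding exp_add by (simp only: left_diff_distrib right_diff_distrib mult.assoc) simp
    then show ?thesis by simp
  qed
  have exp_\<Theta>: "exp (\<Theta> y) = 1" for y
  proof (rule ccontr)
    assume "exp (\<Theta> y) \<noteq> 1"
    moreover have "(\<lambda>y. exp (\<Theta> y) - 1) holomorphic_on UNIV"
      by (intro holomorphic_intros \<Theta>_hol)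
    ultimately obtain z where "q z \<noteq> 0" "exp (\<Theta> z) - 1 \<noteq> 0"
      using entire_common_nonzero[OF hol_q q, of "\<lambda>y. exp (\<Theta> y) - 1" y] by auto
    then show False using prod[of z] by simp
  qed
  have "(\<Theta> has_field_derivative 0) (at y)" for y
  proof -
    obtain D where D: "(\<Theta> has_field_derivative D) (at y)"
      using holomorphic_on_imp_differentiable_at[OF \<Theta>_hol] by (auto simp: field_differentiable_def)
    then have "((\<lambda>y. exp (\<Theta> y)) has_field_derivative exp (\<Theta> y) * D) (at y)"
      by (auto intro!: derivative_eq_intros)
    moreover have "((\<lambda>y. exp (\<Theta> y)) has_field_derivative 0) (at y)"
      unfolding exp_\<Theta> by simp
    ultimately have "exp (\<Theta> y) * D = 0"
      by (rule DERIV_unique)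
    with D show ?thesis by simp
  qed
  then have "\<exists>v. \<forall>y\<in>UNIV. \<Theta> y = v"
    by (intro has_field_derivative_zero_constant) (auto intro: has_field_derivative_at_within)
  then have "\<Theta> y = \<Theta> z1" for y
    by auto
  moreover have "\<Theta> z1 = 0"
    by (simp add: \<Theta>_def algebra_simps)
  ultimately have \<Theta>0: "\<Theta> y = 0" for y
    by metis
  define A where "A = (\<phi> z1 - \<phi> z0) / (z1 - z0)"
  define B where "B = (\<phi> z0 * z1 - \<phi> z1 * z0) / (z1 - z0)"
  have affine: "\<phi> y = A * y + B" for y
  proof -
    have "(z1 - z0) * \<phi> y = (\<phi> z1 - \<phi> z0) * y + (\<phi> z0 * z1 - \<phi> z1 * z0)"
    proof -
      have "(z0 - z1) * \<phi> y + (\<phi> z1 - \<phi> z0) * y + (\<phi> z0 * z1 - \<phi> z1 * z0) = 0"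
        using \<Theta>0[of y] a unfolding \<Theta>_def mult_eq_0_iff by blast
      then show ?thesis by algebra
    qed
    then have "\<phi> y = ((\<phi> z1 - \<phi> z0) * y + (\<phi> z0 * z1 - \<phi> z1 * z0)) / (z1 - z0)"
      using z1(1) by (simp add: field_simps)
    then show ?thesis
      by (simp add: A_def B_def add_divide_distrib)
  qed
  define e where "e = b * z0 + (a * z0 + b) * B - b * (A * z0 + B)"
  have "1 / (k * exp e) * exp ((b + a * B - b * A) * y) * h y = q y" for y
  proof -
    have "E y = e - (b + a * B - b * A) * y"
      by (simp add: E_def e_def affine algebra_simps)
    then have "h y = k * q y * (exp e / exp ((b + a * B - b * A) * y))"
      by (simp add: h_eq exp_diff)
    then show ?thesis using k by simp
  qed
  then show ?thesis
    using that affine by blast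
qed

lemma solve_exp_factor:
  fixes k x h q :: complex
  assumes "k * exp x * h = q" "k \<noteq> 0"
  shows "h = q / k * exp (- x)"
  using assms by (auto simp: exp_minus)

text \<open>
  Once the formula for \<open>h\<close> is inserted, both sides are \<open>q y * q z\<close> times the exponential of the same
  symmetric expression in \<open>y\<close> and \<open>z\<close>; the coefficient \<open>b + a * B - b * A\<close> is what makes the linear
  terms symmetric.
\<close>
lemma kernel_equation_affine:
  fixes h \<phi> :: "complex \<Rightarrow> complex" and a b :: complex and m :: nat
  defines "q \<equiv> \<lambda>z. (a * \<phi> z + b) ^ m"
  assumes \<phi>: "\<And>y. \<phi> y = A * y + B" and C: "C \<noteq> 0"
    and h: "\<And>y. C * exp ((b + a * B - b * A) * y) * h y = q y"
  shows "h y * q z * exp (b * \<phi> z + (a * \<phi> z + b) * y) = h z * q y * exp (b * z + (a * z + b) * \<phi> y)"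
proof -
  let ?D = "b + a * B - b * A"
  have h: "h y = q y / C * exp (- (?D * y))" for y
    by (rule solve_exp_factor[OF h C])
  have "h y * q z * exp (b * \<phi> z + (a * \<phi> z + b) * y)
      = q y * q z / C * exp (- (?D * y) + (b * \<phi> z + (a * \<phi> z + b) * y))"
    unfolding h[of y] exp_add[of "- (?D * y)"] by (simp only: mult_ac times_divide_eq_left times_divide_eq_right)
  also have "- (?D * y) + (b * \<phi> z + (a * \<phi> z + b) * y) = - (?D * z) + (b * z + (a * z + b) * \<phi> y)"
    by (simp add: \<phi> algebra_simps)
  also have "q y * q z / C * exp \<dots> = h z * q y * exp (b * z + (a * z + b) * \<phi> y)"
    unfolding h[of z] exp_add[of "- (?D * z)"] by (simp only: mult_ac times_divide_eq_left times_divide_eq_right)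
  finally show ?thesis .
qed

lemma higher_deriv_power_mult_at_0:
  assumes G: "G holomorphic_on UNIV"
  shows "(deriv ^^ n) (\<lambda>w. w ^ m * G w) 0
    = (if n < m then 0 else of_nat (n choose m) * fact m * (deriv ^^ (n - m)) G (0 :: complex))"
proof -
  have power: "(deriv ^^ i) (\<lambda>w. w ^ m) (0 :: complex) = (if i = m then fact m else 0)" for i
  proof -
    have "(\<lambda>i. (if i = m then 1 else 0) * u ^ i) sums u ^ m" for u :: complex
      using sums_single[of m "\<lambda>i. u ^ i"] by (simp add: if_distrib[of "\<lambda>x. x * _"] cong: if_cong)
    from power_series_coeff_unique[OF this, of i] show ?thesis
      by (auto simp: field_simps split: if_splits)
  qed
  have "(deriv ^^ n) (\<lambda>w. w ^ m * G w) 0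
      = (\<Sum>i = 0..n. of_nat (n choose i) * (deriv ^^ i) (\<lambda>w. w ^ m) 0 * (deriv ^^ (n - i)) G 0)"
    by (rule higher_deriv_mult[of _ UNIV]) (auto intro!: holomorphic_intros G)
  also have "\<dots> = (\<Sum>i = 0..n. if i = m then of_nat (n choose m) * fact m * (deriv ^^ (n - m)) G 0 else 0)"
    by (intro sum.cong) (auto simp: power)
  finally show ?thesis by (simp add: sum.delta)
qed

lemma higher_deriv_comp: "(deriv ^^ j) ((deriv ^^ m) g) = (deriv ^^ (j + m)) g"
  by (simp add: funpow_add)

section \<open>Symmetry of the bilinear form on solutions\<close>

context conjugation_parameters
begin

text \<open>
  The affine map sends \<open>s\<close> to \<open>cnj b = - b / a\<close>, the zero of \<open>a * z + b\<close>. The Abel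
  series for \<open>C f\<close> is taken at \<open>s\<close>, and \<open>w \<mapsto> t * w + s\<close> is the parametrisation by the
  value \<open>w\<close> of \<open>a * (A * y + B) + b\<close>. The exponential factors cancel exactly because the exponent in
  the formula for \<open>h\<close> satisfies \<open>(b + a * B - b * A) * t = cnj b - s\<close>.
\<close>
lemma fock_inner_symmetric_of_affine:
  assumes mem: "f \<in> fock_space" "g \<in> fock_space" "u \<in> fock_space" "v \<in> fock_space"
    and fg: "\<And>y. f (A * y + B) = h y * (deriv ^^ m) g y"
    and uv: "\<And>y. u (A * y + B) = h y * (deriv ^^ m) v y"
    and k: "k \<noteq> 0" and h: "\<And>y. k * exp ((b + a * B - b * A) * y) * h y = (a * (A * y + B) + b) ^ m"
    and A: "A \<noteq> 0"
  shows "fock_inner v (C f) = fock_inner g (C u)"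
proof -
  let ?D = "b + a * B - b * A"
  define s where "s = (cnj b - B) / A"
  define t where "t = cnj a / A"
  define K where "K = cnj c * exp (- (?D * s)) / k"
  \<comment> \<open>the factor in \<open>H\<^sup>(\<^sup>n\<^sup>) 0 = M n * g\<^sup>(\<^sup>n\<^sup>) s\<close>; it is common to all solutions, whence the symmetry\<close>
  define M where "M n = (if n < m then 0 else K * (of_nat (n choose m) * fact m * t ^ (n - m)))" for n
  have lim: "((\<lambda>r::real. \<Sum>n. of_real r ^ n * (M n * (deriv ^^ n) g s * (deriv ^^ n) v s / fact n))
      \<longlongrightarrow> fock_inner v (C f)) (at_left 1)"
    if mem: "f \<in> fock_space" "g \<in> fock_space" "v \<in> fock_space"
      and fg: "\<And>y. f (A * y + B) = h y * (deriv ^^ m) g y" for f g v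
  proof -
    define H where "H w = cnj c * exp ((cnj b - s) * w) * f (cnj a * w + cnj b)" for w
    have H_hol: "H holomorphic_on UNIV"
      unfolding H_def by (intro holomorphic_intros entire_compose_affine fock_spaceD(1)[OF mem(1)])
    have CH: "C f z = cnj (H (cnj z) * exp (s * cnj z))" for z
    proof -
      have "H (cnj z) * exp (s * cnj z) = cnj c * (exp ((cnj b - s) * cnj z) * exp (s * cnj z)) * f (cnj a * cnj z + cnj b)"
        unfolding H_def by (simp only: mult_ac)
      also have "exp ((cnj b - s) * cnj z) * exp (s * cnj z) = exp (cnj b * cnj z)"
        unfolding exp_add[symmetric] by (simp add: algebra_simps)
      finally have "H (cnj z) * exp (s * cnj z) = cnj c * exp (cnj b * cnj z) * f (cnj a * cnj z + cnj b)" .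
      then show ?thesis by (simp add: wc_conjugation_def exp_cnj)
    qed
    have H_eq: "H w = K * (w ^ m * (deriv ^^ m) g (t * w + s))" for w
    proof -
      let ?y = "t * w + s"
      have y: "A * ?y + B = cnj a * w + cnj b"
        using A by (simp add: t_def s_def field_simps)
      have "a * (A * ?y + B) + b = (a * cnj a) * w + (a * cnj b + b)"
        unfolding y by (simp add: algebra_simps)
      then have q: "a * (A * ?y + B) + b = w"
        by (simp add: cnj_a a_cnj_b)
      have Dt: "?D * t = cnj b - s"
      proof -
        have "?D * cnj a = (cnj a * b) + (cnj a * a) * B - (cnj a * b) * A"
          by (simp add: algebra_simps)
        also have "\<dots> = A * cnj b - (cnj b - B)"
          by (simp add: cnj_a a_cnj_b)
        finally show ?thesis
          using A by (simp add: t_def s_def field_simps)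
      qed
      have "f (cnj a * w + cnj b) = h ?y * (deriv ^^ m) g ?y"
        using fg[of ?y] unfolding y .
      also have "h ?y = w ^ m / k * exp (- (?D * ?y))"
        using solve_exp_factor[OF h[of ?y] k] unfolding q .
      also have "?D * ?y = (cnj b - s) * w + ?D * s"
        unfolding Dt[symmetric] by (simp add: algebra_simps)
      finally have "H w = (exp ((cnj b - s) * w) * exp (- ((cnj b - s) * w + ?D * s))) * (cnj c * (w ^ m / k * (deriv ^^ m) g ?y))"
        unfolding H_def by (simp only: mult_ac)
      also have "exp ((cnj b - s) * w) * exp (- ((cnj b - s) * w + ?D * s)) = exp (- (?D * s))"
        by (simp flip: exp_add)
      finally show ?thesis
        by (simp add: K_def)
    qed
    define G where "G w = (deriv ^^ m) g (t * w + s)" for w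
    have dg: "(deriv ^^ m) g holomorphic_on UNIV"
      by (intro holomorphic_higher_deriv fock_spaceD(1)[OF mem(2)]) auto
    have G_hol: "G holomorphic_on UNIV"
      unfolding G_def by (intro entire_compose_affine dg)
    have G_deriv: "(deriv ^^ j) G 0 = t ^ j * (deriv ^^ (j + m)) g s" for j
      using higher_deriv_compose_linear'[OF dg, of UNIV 0 t s j] by (simp add: G_def[abs_def] higher_deriv_comp)
    have H_deriv: "(deriv ^^ n) H 0 = M n * (deriv ^^ n) g s" for n
    proof -
      have "H = (\<lambda>w. K * (w ^ m * G w))"
        by (simp add: fun_eq_iff H_eq G_def)
      moreover have "(\<lambda>w. w ^ m * G w) holomorphic_on UNIV"
        by (intro holomorphic_intros G_hol)
      ultimately have "(deriv ^^ n) H 0 = K * (deriv ^^ n) (\<lambda>w. w ^ m * G w) 0"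
        using higher_deriv_cmult[of "\<lambda>w. w ^ m * G w" UNIV 0 n K] by simp
      then show ?thesis
        by (simp add: higher_deriv_power_mult_at_0[OF G_hol] G_deriv M_def)
    qed
    have "((\<lambda>r::real. \<Sum>n. of_real r ^ n * ((deriv ^^ n) H 0 / fact n * (deriv ^^ n) v s))
      \<longlongrightarrow> fock_inner v (C f)) (at_left 1)"
      by (rule fock_inner_Abel_summation[OF mem(3) C_fock[OF mem(1)] H_hol CH])
    then show ?thesis
      by (simp add: H_deriv)
  qed
  have swap: "M n * (deriv ^^ n) g s * (deriv ^^ n) v s / fact n = M n * (deriv ^^ n) v s * (deriv ^^ n) g s / fact n" for n
    by simp
  show ?thesis
    using lim[OF mem(1,2,4) fg] lim[OF mem(3,4,2) uv] unfolding swap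
    by (rule tendsto_unique[rotated]) simp
qed

text \<open>
  For \<open>A = 0\<close> (which leaves \<open>m = 0\<close>) the operator has rank one: \<open>g\<close> is a multiple of the conjugated
  kernel at \<open>B\<close>, with a factor proportional to \<open>f B\<close>.
\<close>
lemma fock_inner_symmetric_of_constant:
  assumes mem: "f \<in> fock_space" "g \<in> fock_space" "u \<in> fock_space" "v \<in> fock_space"
    and fg: "\<And>y. f B = h y * g y" and uv: "\<And>y. u B = h y * v y"
    and k: "k \<noteq> 0" and h: "\<And>y. k * exp ((b + a * B) * y) * h y = 1"
  shows "fock_inner v (C f) = fock_inner g (C u)"
proof -
  define K where "K = k / (c * exp (b * B))"
  have eq: "g = (\<lambda>y. (f B * K) * C (fock_kernel 0 B) y)"
    if fg: "\<And>y. f B = h y * g y" for f g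
  proof
    fix y
    have "C (fock_kernel 0 B) y = (c * exp (b * B)) * exp ((b + a * B) * y)"
      unfolding C_kernel mult.assoc by (simp add: algebra_simps flip: exp_add)
    then have "K * C (fock_kernel 0 B) y = k * exp ((b + a * B) * y)"
      using c_nonzero by (simp add: K_def)
    then have "(f B * K) * C (fock_kernel 0 B) y = f B * (k * exp ((b + a * B) * y))"
      by (simp only: mult.assoc)
    also have "\<dots> = (k * exp ((b + a * B) * y) * h y) * g y"
      by (simp only: fg[of y] mult_ac)
    finally show "g y = (f B * K) * C (fock_kernel 0 B) y"
      by (simp add: h)
  qed
  have "fock_inner g (C u) = (f B * K) * u B" "fock_inner v (C f) = (u B * K) * f B"
    using eq[of f g, OF fg] eq[of u v, OF uv] fock_inner_C_kernel[OF mem(3), of 0 B] fock_inner_C_kernel[OF mem(1), of 0 B]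
    by (simp_all add: fock_inner_cmult_left)
  then show ?thesis by simp
qed

section \<open>The maximal operator as an adjoint\<close>

text \<open>
  Since \<open>psi\<close> has no zeros, the equation only involves the entire quotient \<open>h = phi / psi\<close>, and
  the maximal operator is the graph below.
\<close>
definition eq_graph :: "nat \<Rightarrow> (complex \<Rightarrow> complex) \<Rightarrow> (complex \<Rightarrow> complex) \<Rightarrow> fock_graph" where
  "eq_graph m \<phi> h = {(f, g). f \<in> fock_space \<and> g \<in> fock_space \<and> (\<forall>z. f (\<phi> z) = h z * (deriv ^^ m) g z)}"

text \<open>
  The pair whose annihilator consists of the \<open>(f, g)\<close> that satisfy the equation at \<open>y\<close>.
\<close>
definition kernel_pair :: "nat \<Rightarrow> (complex \<Rightarrow> complex) \<Rightarrow> (complex \<Rightarrow> complex) \<Rightarrow> complex \<Rightarrow> (complex \<Rightarrow> complex) \<times> (complex \<Rightarrow> complex)" where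
  "kernel_pair m \<phi> h y = ((\<lambda>z. h y * C (fock_kernel m y) z), C (fock_kernel 0 (\<phi> y)))"

lemma conj_adjoint_antimono: "G \<subseteq> G' \<Longrightarrow> conj_adjoint C G' \<subseteq> conj_adjoint C G"
  by (auto simp: conj_adjoint_def)

lemma kernel_pair_annihilates_iff:
  assumes "f \<in> fock_space" "g \<in> fock_space"
  shows "fock_inner (snd (kernel_pair m \<phi> h y)) (C f) = fock_inner (fst (kernel_pair m \<phi> h y)) (C g)
    \<longleftrightarrow> f (\<phi> y) = h y * (deriv ^^ m) g y"
  using fock_inner_C_kernel[OF assms(1), of 0 "\<phi> y"] fock_inner_C_kernel[OF assms(2), of m y]
  by (simp add: kernel_pair_def fock_inner_cmult_left)

lemma eq_graph_eq_adjoint: "eq_graph m \<phi> h = conj_adjoint C (range (kernel_pair m \<phi> h))"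
  by (auto simp: eq_graph_def conj_adjoint_def split_beta kernel_pair_annihilates_iff)

lemma kernel_pair_fock: "kernel_pair m \<phi> h y \<in> fock_space \<times> fock_space"
  by (simp add: kernel_pair_def C_fock fock_space_kernel fock_space_cmult)

text \<open>
  The annihilation of \<open>(f, g)\<close> by the kernel pair is turned around by the symmetry of the bilinear
  form.
\<close>
lemma kernel_pair_in_adjoint:
  assumes "G \<subseteq> eq_graph m \<phi> h"
  shows "kernel_pair m \<phi> h y \<in> conj_adjoint C G"
proof -
  obtain u v where uv: "kernel_pair m \<phi> h y = (u, v)" by fastforce
  then have mem: "u \<in> fock_space" "v \<in> fock_space"
    using kernel_pair_fock[of m \<phi> h y] by auto
  have "fock_inner g (C u) = fock_inner f (C v)" if "(f, g) \<in> G" for f g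
  proof -
    have fg: "f \<in> fock_space" "g \<in> fock_space" "f (\<phi> y) = h y * (deriv ^^ m) g y"
      using assms that by (auto simp: eq_graph_def)
    then have "fock_inner v (C f) = fock_inner u (C g)"
      using kernel_pair_annihilates_iff[OF fg(1,2), of m \<phi> h y] uv by simp
    then show ?thesis
      using fock_inner_C_sym fg mem by metis
  qed
  then show ?thesis
    unfolding uv using mem by (auto simp: conj_adjoint_def)
qed

text \<open>
  The conjugated kernels are exponentials times powers, so the equation for a kernel pair is explicit.
\<close>
lemma kernel_pair_in_eq_graph_iff:
  "kernel_pair m \<phi> h y \<in> eq_graph m \<phi> h \<longleftrightarrow>
    (\<forall>z. h y * (a * \<phi> z + b) ^ m * exp (b * \<phi> z + (a * \<phi> z + b) * y)
       = h z * (a * \<phi> y + b) ^ m * exp (b * z + (a * z + b) * \<phi> y))"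
proof -
  have Ck: "C (fock_kernel 0 (\<phi> y)) = (\<lambda>z. (c * exp (b * \<phi> y)) * exp ((a * \<phi> y + b) * z))"
  proof
    fix z
    have "C (fock_kernel 0 (\<phi> y)) z = c * exp (b * z + (a * z + b) * \<phi> y)"
      unfolding C_kernel exp_add by simp
    also have "b * z + (a * z + b) * \<phi> y = b * \<phi> y + (a * \<phi> y + b) * z"
      by (simp add: algebra_simps)
    finally show "C (fock_kernel 0 (\<phi> y)) z = (c * exp (b * \<phi> y)) * exp ((a * \<phi> y + b) * z)"
      by (simp only: exp_add mult.assoc)
  qed
  have deriv: "(deriv ^^ m) (C (fock_kernel 0 (\<phi> y))) z = c * ((a * \<phi> y + b) ^ m * exp (b * z + (a * z + b) * \<phi> y))" for z
  proof -
    have e: "b * z + (a * z + b) * \<phi> y = b * \<phi> y + (a * \<phi> y + b) * z"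
      by (simp add: algebra_simps)
    show ?thesis
      unfolding e exp_add Ck higher_deriv_exp_linear by (simp only: mult_ac)
  qed
  have val: "h y * C (fock_kernel m y) (\<phi> z) = c * (h y * (a * \<phi> z + b) ^ m * exp (b * \<phi> z + (a * \<phi> z + b) * y))" for z
    unfolding C_kernel exp_add by (simp only: mult_ac)
  show ?thesis
    using c_nonzero
    by (simp add: eq_graph_def kernel_pair_def C_fock fock_space_kernel fock_space_cmult deriv val)
      (simp add: mult.assoc mult.left_commute[of _ c])
qed

text \<open>
  The inclusion of the adjoint in the graph only needs the kernel pairs to be solutions; the reverse
  inclusion is the symmetry of the bilinear form.
\<close>
lemma eq_graph_selfadjoint:
  assumes \<phi>: "\<And>y. \<phi> y = A * y + B" and k: "k \<noteq> 0"
    and h: "\<And>y. k * exp ((b + a * B - b * A) * y) * h y = (a * \<phi> y + b) ^ m"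
    and nonconst: "m = 0 \<or> A \<noteq> 0"
  shows "conj_adjoint C (eq_graph m \<phi> h) = eq_graph m \<phi> h"
proof
  have "range (kernel_pair m \<phi> h) \<subseteq> eq_graph m \<phi> h"
    using kernel_pair_in_eq_graph_iff kernel_equation_affine[OF \<phi> k h] by blast
  then show "conj_adjoint C (eq_graph m \<phi> h) \<subseteq> eq_graph m \<phi> h"
    using conj_adjoint_antimono eq_graph_eq_adjoint by metis
  show "eq_graph m \<phi> h \<subseteq> conj_adjoint C (eq_graph m \<phi> h)"
  proof (clarify)
    fix u v assume "(u, v) \<in> eq_graph m \<phi> h"
    then have u: "u \<in> fock_space" and v: "v \<in> fock_space" and uv: "\<And>y. u (\<phi> y) = h y * (deriv ^^ m) v y"
      by (auto simp: eq_graph_def)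
    have "fock_inner g (C u) = fock_inner f (C v)" if "(f, g) \<in> eq_graph m \<phi> h" for f g
    proof -
      from that have f: "f \<in> fock_space" and g: "g \<in> fock_space" and fg: "\<And>y. f (\<phi> y) = h y * (deriv ^^ m) g y"
        by (auto simp: eq_graph_def)
      have "fock_inner v (C f) = fock_inner g (C u)"
      proof (cases "A = 0")
        case True
        then show ?thesis
          using nonconst h fg uv
          by (intro fock_inner_symmetric_of_constant[OF f g u v _ _ k, of B h]) (auto simp: \<phi>)
      next
        case False
        then show ?thesis
          using fock_inner_symmetric_of_affine[OF f g u v, of A B h m k] fg uv h k by (simp add: \<phi>)
      qed
      then show ?thesis
        using fock_inner_C_sym[OF f v] by simp
    qed
    then show "(u, v) \<in> conj_adjoint C (eq_graph m \<phi> h)"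
      using u v by (auto simp: conj_adjoint_def)
  qed
qed

end

section \<open>The characterisation\<close>

text \<open>
  Equivalent triples have the same quotient \<open>h\<close>, because two entire functions that agree off a
  sparse set agree everywhere; and \<open>(psi, varphi, phi)\<close> is equivalent to itself.
\<close>
lemma equivalent_triples_affine_iff:
  fixes psi varphi phi q :: "complex \<Rightarrow> complex"
  assumes hol: "psi holomorphic_on UNIV" "varphi holomorphic_on UNIV" "phi holomorphic_on UNIV" "q holomorphic_on UNIV"
    and psi: "\<And>z. psi z \<noteq> 0"
  shows "(\<exists>psi1 phi1. equivalent_triples (psi, varphi, phi) (psi1, varphi, phi1) \<and>
      (\<forall>y. C * exp (D * y) * phi1 y = psi1 y * q y))
    \<longleftrightarrow> (\<forall>y. C * exp (D * y) * (phi y / psi y) = q y)"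
proof
  assume "\<exists>psi1 phi1. equivalent_triples (psi, varphi, phi) (psi1, varphi, phi1) \<and>
      (\<forall>y. C * exp (D * y) * phi1 y = psi1 y * q y)"
  then obtain psi1 phi1 y0 where hol1: "psi1 holomorphic_on UNIV" and y0: "psi1 y0 \<noteq> 0"
    and quot: "\<forall>\<^sub>F z in cosparse UNIV. phi z / psi z = phi1 z / psi1 z"
    and eq: "\<And>y. C * exp (D * y) * phi1 y = psi1 y * q y"
    by (auto simp: equivalent_triples_def)
  define d where "d y = C * exp (D * y) * (phi y / psi y) - q y" for y
  have d: "d holomorphic_on UNIV"
    unfolding d_def using psi by (intro holomorphic_intros hol) auto
  have "\<forall>\<^sub>F z in at y0. phi z / psi z = phi1 z / psi1 z"
    using eventually_cosparse_imp_eventually_at[OF quot, of y0 UNIV] by simp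
  moreover have "\<forall>\<^sub>F z in at y0. psi1 z \<noteq> 0"
    using entire_continuous_on[OF hol1, of UNIV] y0
    by (intro tendsto_imp_eventually_ne[of psi1 "psi1 y0"]) (auto simp: continuous_on_def)
  ultimately have "\<forall>\<^sub>F z in at y0. d z = 0"
  proof eventually_elim
    case (elim z)
    have "C * exp (D * z) * (phi1 z / psi1 z) = q z"
      using eq[of z] elim(2) by (simp add: field_simps)
    then show ?case using elim by (simp add: d_def)
  qed
  then have lim: "y0 islimpt {z. d z = 0}"
    unfolding islimpt_conv_frequently_at by (intro eventually_frequently) simp_all
  have "d y = 0" for y
    by (rule analytic_continuation[OF d open_UNIV connected_UNIV subset_UNIV UNIV_I lim _ UNIV_I]) simp
  then show "\<forall>y. C * exp (D * y) * (phi y / psi y) = q y"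
    by (simp add: d_def)
next
  assume *: "\<forall>y. C * exp (D * y) * (phi y / psi y) = q y"
  have "C * exp (D * y) * phi y = psi y * q y" for y
    unfolding *[rule_format, of y, symmetric] using psi[of y] by simp
  moreover have "equivalent_triples (psi, varphi, phi) (psi, varphi, phi)"
    using hol psi by (simp add: equivalent_triples_def)
  ultimately show "\<exists>psi1 phi1. equivalent_triples (psi, varphi, phi) (psi1, varphi, phi1) \<and>
      (\<forall>y. C * exp (D * y) * phi1 y = psi1 y * q y)"
    by blast
qed

theorem theorem5p4:
  fixes m :: nat and a b c :: complex
    and psi varphi phi :: "complex \<Rightarrow> complex"
    and S :: fock_graph
  assumes "cmod a = 1"
    and "cnj a * b + cnj b = 0"
    and "(cmod c)\<^sup>2 * exp ((cmod b)\<^sup>2) = 1"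
    and "psi holomorphic_on UNIV"
    and "varphi holomorphic_on UNIV"
    and "phi holomorphic_on UNIV"
    and "\<exists>z. phi z \<noteq> 0"
    and "\<forall>z. psi z \<noteq> 0"
    and "m = 0 \<or> \<not> varphi constant_on UNIV"
    and "multivalued_weighted_composition_operator m psi varphi phi S"
  shows "conj_selfadjoint (wc_conjugation a b c) S \<longleftrightarrow>
    S = S_max m psi varphi phi \<and>
    (\<exists>psi1 phi1 A B C.
       equivalent_triples (psi, varphi, phi) (psi1, varphi, phi1) \<and>
       (let D = b + a * B - b * A in
        \<forall>y. varphi y = A * y + B \<and>
            C * exp (D * y) * phi1 y = psi1 y * (a * (A * y + B) + b) ^ m))"
proof -
  interpret conjugation_parameters a b c
    using assms(1-3) by unfold_locales
  define h where "h z = phi z / psi z" for z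
  define G where "G = eq_graph m varphi h"
  have h: "h holomorphic_on UNIV" and psi: "\<And>z. psi z \<noteq> 0"
    unfolding h_def using assms(4,6,8) by (auto intro!: holomorphic_intros)
  obtain x where x: "h x \<noteq> 0"
    using assms(7) psi by (auto simp: h_def)
  have Smax: "S_max m psi varphi phi = G"
    unfolding S_max_def G_def eq_graph_def h_def using psi by (simp add: field_simps)
  have SG: "S \<subseteq> G"
    using assms(10) by (simp add: multivalued_weighted_composition_operator_def Smax)
  have q: "\<exists>x. (a * varphi x + b) ^ m \<noteq> 0"
  proof (rule ccontr)
    assume "\<nexists>x. (a * varphi x + b) ^ m \<noteq> 0"
    then have "m \<noteq> 0" "a * varphi x + b = 0" for x by auto
    then have "m \<noteq> 0" "varphi x = - b / a" for x
      using a_nonzero by (auto simp: field_simps eq_neg_iff_add_eq_0)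
    then show False
      using assms(9) by (auto simp: constant_on_def)
  qed
  define cond where "cond \<longleftrightarrow> (\<exists>A B k. (\<forall>y. varphi y = A * y + B) \<and>
      (\<forall>y. k * exp ((b + a * B - b * A) * y) * h y = (a * (A * y + B) + b) ^ m))"
  have "(\<exists>psi1 phi1 A B C.
       equivalent_triples (psi, varphi, phi) (psi1, varphi, phi1) \<and>
       (let D = b + a * B - b * A in
        \<forall>y. varphi y = A * y + B \<and>
            C * exp (D * y) * phi1 y = psi1 y * (a * (A * y + B) + b) ^ m))
    \<longleftrightarrow> (\<exists>A B C. (\<forall>y. varphi y = A * y + B) \<and>
      (\<exists>psi1 phi1. equivalent_triples (psi, varphi, phi) (psi1, varphi, phi1) \<and>
        (\<forall>y. C * exp ((b + a * B - b * A) * y) * phi1 y = psi1 y * (a * (A * y + B) + b) ^ m)))"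
    unfolding Let_def by blast
  also have "\<dots> \<longleftrightarrow> cond"
  proof -
    have "(\<exists>psi1 phi1. equivalent_triples (psi, varphi, phi) (psi1, varphi, phi1) \<and>
        (\<forall>y. C * exp (D * y) * phi1 y = psi1 y * (a * (A * y + B) + b) ^ m))
      \<longleftrightarrow> (\<forall>y. C * exp (D * y) * h y = (a * (A * y + B) + b) ^ m)" for A B C D
      unfolding h_def by (rule equivalent_triples_affine_iff) (auto intro!: holomorphic_intros assms psi)
    then show ?thesis by (simp add: cond_def)
  qed
  finally have cond: "(\<exists>psi1 phi1 A B C.
       equivalent_triples (psi, varphi, phi) (psi1, varphi, phi1) \<and>
       (let D = b + a * B - b * A in
        \<forall>y. varphi y = A * y + B \<and>
            C * exp (D * y) * phi1 y = psi1 y * (a * (A * y + B) + b) ^ m)) \<longleftrightarrow> cond" .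
  have sufficient: "conj_adjoint C G = G" if cond
  proof -
    from that obtain A B k where phi: "\<And>y. varphi y = A * y + B"
      and k: "\<And>y. k * exp ((b + a * B - b * A) * y) * h y = (a * varphi y + b) ^ m"
      unfolding cond_def by auto
    have "k \<noteq> 0" using q k by fastforce
    moreover have "m = 0 \<or> A \<noteq> 0"
      using assms(9) phi by (auto simp: constant_on_def)
    ultimately show ?thesis
      unfolding G_def by (intro eq_graph_selfadjoint[OF phi _ k])
  qed
  have necessary: "cond \<and> S = G" if adj: "conj_adjoint C S = S"
  proof -
    have "kernel_pair m varphi h y \<in> G" for y
      using kernel_pair_in_adjoint[of S m varphi h y] SG adj unfolding G_def by auto
    then have eq: "h y * (a * varphi z + b) ^ m * exp (b * varphi z + (a * varphi z + b) * y)
        = h z * (a * varphi y + b) ^ m * exp (b * z + (a * z + b) * varphi y)" for y z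
      unfolding G_def kernel_pair_in_eq_graph_iff by blast
    obtain x' where x': "(a * varphi x' + b) ^ m \<noteq> 0"
      using q by blast
    obtain A B k where AB: "\<And>y. varphi y = A * y + B"
      "\<And>y. k * exp ((b + a * B - b * A) * y) * h y = (a * varphi y + b) ^ m"
      by (rule kernel_equation_solution[OF a_nonzero assms(5) h x x' eq]) blast
    have cond
      unfolding cond_def using AB by (intro exI[of _ A] exI[of _ B] exI[of _ k]) auto
    \<comment> \<open>\<open>S\<close> and \<open>G\<close> are their own adjoints, and adjoints reverse the inclusion of \<open>S\<close> in \<open>G\<close>\<close>
    moreover have "G \<subseteq> S"
      using conj_adjoint_antimono[OF SG] sufficient[OF \<open>cond\<close>] adj by simp
    ultimately show ?thesis using SG by auto
  qed
  show ?thesis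
    unfolding cond conj_selfadjoint_def Smax using sufficient necessary by auto
qed

end
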